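(* Let $2\le \Delta\le n-1$ and let $G$ be a unicyclic graph with $n$ vertices and maximum degree $\Delta$. Then $$\chi(G)\le \begin{cases}\dfrac{n-\Delta-1}{\sqrt{3}}+\dfrac{n-\Delta+1}{\sqrt{\Delta+2}}+\dfrac{2\Delta-n-1}{\sqrt{\Delta+1}}+\dfrac12 & \text{if } \frac{n+2}{2}\le\Delta\le n-1,\\[2mm] \dfrac{\Delta-2}{\sqrt3}+\dfrac{\Delta}{\sqrt{\Delta+2}}+\dfrac12(n-2\Delta+2) & \text{if } 2\le \Delta\le \frac{n+1}{2},\end{cases}$$ with equality if and only if $G=U_{n,\Delta}$ in the case $\frac{n+2}{2}\le\Delta\le n-1$, and, in the case $2\le\Delta\le\frac{n+1}{2}$, if and only if $G$ is a unicyclic graph obtained by attaching $\Delta-2$ paths of length at least two to a single vertex of a cycle.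
   Context: A unicyclic graph is a connected simple graph containing exactly one cycle. For a graph $G$ and vertex $v$, $d_v$ denotes the degree of $v$. The sum-connectivity index is $\chi(G)=\sum_{uv\in E(G)}(d_u+d_v)^{-1/2}$. Attaching a path of length $r$ to a vertex $u$ means adding a new path on $r$ vertices and an edge between $u$ and one terminal vertex of that path (for $r=1$ this attaches a pendant vertex, i.e., a vertex of degree one). For $\frac{n+2}{2}\le\Delta\le n-1$, $U_{n,\Delta}$ is the unicyclic graph obtained by attaching $2\Delta-n-1$ pendant vertices and $n-\Delta-1$ paths of length two to one vertex of a triangle. *)

theory Defs
  imports Complex_Main
begin

type_synonym 'a graph = "'a set \<times> 'a set set"

abbreviation verts :: "'a graph \<Rightarrow> 'a set" where
  "verts G \<equiv> fst G"

abbreviation edges :: "'a graph \<Rightarrow> 'a set set" where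
  "edges G \<equiv> snd G"

definition simple_graph :: "'a graph \<Rightarrow> bool" where
  "simple_graph G \<longleftrightarrow>
     finite (verts G) \<and> (\<forall>e\<in>edges G. e \<subseteq> verts G \<and> card e = 2)"

definition subgraph :: "'a graph \<Rightarrow> 'a graph \<Rightarrow> bool" where
  "subgraph H G \<longleftrightarrow> verts H \<subseteq> verts G \<and> edges H \<subseteq> edges G"

definition graph_iso :: "'a graph \<Rightarrow> 'b graph \<Rightarrow> bool" where
  "graph_iso G H \<longleftrightarrow>
     (\<exists>f. bij_betw f (verts G) (verts H) \<and> edges H = (\<lambda>e. f ` e) ` edges G)"

definition graph_connected :: "'a graph \<Rightarrow> bool" where
  "graph_connected G \<longleftrightarrow>
     verts G \<noteq> {} \<and>
     (\<forall>u\<in>verts G. \<forall>v\<in>verts G. (u, v) \<in> {(x, y). {x, y} \<in> edges G}\<^sup>*)"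

definition degree :: "'a graph \<Rightarrow> 'a \<Rightarrow> nat" where
  "degree G v = card {e \<in> edges G. v \<in> e}"

definition max_degree :: "'a graph \<Rightarrow> nat" where
  "max_degree G = Max (degree G ` verts G)"

text \<open>Every edge \<open>e = {u, v}\<close> of a simple graph has two distinct ends, so the inner sum
  is \<open>d\<^sub>u + d\<^sub>v\<close>.\<close>

definition sum_connectivity :: "'a graph \<Rightarrow> real" where
  "sum_connectivity G = (\<Sum>e\<in>edges G. real (\<Sum>v\<in>e. degree G v) powr (-1/2))"

fun path_edges :: "'a list \<Rightarrow> 'a set set" where
  "path_edges (x # y # xs) = insert {x, y} (path_edges (y # xs))"
| "path_edges _ = {}"

definition cycle_graph :: "'a list \<Rightarrow> 'a graph" where
  "cycle_graph xs = (set xs, path_edges (xs @ [hd xs]))"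

definition is_cycle :: "'a graph \<Rightarrow> bool" where
  "is_cycle C \<longleftrightarrow> (\<exists>xs. distinct xs \<and> 3 \<le> length xs \<and> C = cycle_graph xs)"

text \<open>Cycles are counted as subgraphs, so rotations and reversals of a vertex sequence
  give the same cycle.\<close>

definition unicyclic :: "'a graph \<Rightarrow> bool" where
  "unicyclic G \<longleftrightarrow>
     simple_graph G \<and> graph_connected G \<and> (\<exists>!C. is_cycle C \<and> subgraph C G)"

text \<open>The list \<open>p\<close> consists of the new vertices, in order along the path and starting with
  the neighbour of \<open>u\<close>; thus the attached path has length \<open>r = length p\<close>. That the vertices are
  new and distinct is required where these operations are used.\<close>

definition attach_path :: "'a \<Rightarrow> 'a graph \<Rightarrow> 'a list \<Rightarrow> 'a graph" where
  "attach_path u G p = (verts G \<union> set p, edges G \<union> path_edges (u # p))"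

definition attach_paths :: "'a \<Rightarrow> 'a graph \<Rightarrow> 'a list list \<Rightarrow> 'a graph" where
  "attach_paths u G ps = foldl (attach_path u) G ps"

text \<open>A representative of \<open>U\<^sub>n\<^sub>,\<^sub>\<Delta>\<close> on the vertices \<open>0, \<dots>, n - 1\<close>: the triangle is \<open>0, 1, 2\<close>, the
  \<open>2\<Delta> - n - 1\<close> pendant vertices are \<open>3, \<dots>, 2\<Delta> - n + 1\<close>, and the remaining vertices form the
  paths of length two. It is meant for \<open>n + 2 \<le> 2\<Delta>\<close> and \<open>\<Delta> \<le> n - 1\<close>, where no subtraction
  truncates.\<close>

definition U_graph :: "nat \<Rightarrow> nat \<Rightarrow> nat graph" where
  "U_graph n \<Delta> =
     attach_paths 0 (cycle_graph [0, 1, 2])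
       (map (\<lambda>i. [3 + i]) [0..<2 * \<Delta> - n - 1] @
        map (\<lambda>j. [2 * \<Delta> - n + 2 + 2 * j, 2 * \<Delta> - n + 3 + 2 * j]) [0..<n - \<Delta> - 1])"

text \<open>No isomorphism is needed here, since the cycle and the paths range over all labellings.\<close>

definition cycle_with_long_paths :: "nat \<Rightarrow> 'a graph \<Rightarrow> bool" where
  "cycle_with_long_paths k G \<longleftrightarrow>
     (\<exists>C u ps. is_cycle C \<and> u \<in> verts C \<and>
        length ps = k \<and> (\<forall>p\<in>set ps. 2 \<le> length p) \<and>
        distinct (concat ps) \<and> set (concat ps) \<inter> verts C = {} \<and>
        G = attach_paths u C ps)"

end

theory Submission
  imports Defs
begin

text \<open>Let \<open>x\<close> have degree \<open>\<Delta>\<close>. The weight of every edge is split between its ends. Away from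
  \<open>x\<close>, a vertex of degree \<open>d\<close> receives a potential \<open>p(d)\<close> with \<open>1 / \<surd>(a + b) \<le> p(a) + p(b)\<close>;
  on the edges at \<open>x\<close> the split is exact. The share of a vertex other than \<open>x\<close> is then at most an
  affine function of its degree, minus a fixed \<open>s \<ge> 0\<close> if the vertex is a pendant neighbour of \<open>x\<close>.
  Equality holds for degrees at most \<open>2\<close> and fails from degree \<open>3\<close> on. A unicyclic graph has as
  many edges as vertices, so summation gives \<open>\<chi>(G) \<le> B - s L\<close>, where \<open>B\<close> is the second bound and
  \<open>L\<close> the number of pendant neighbours of \<open>x\<close>. Counting pendant vertices gives \<open>L \<ge> 2\<Delta> - n - 1\<close>,
  and \<open>B - s (2\<Delta> - n - 1)\<close> is the first bound. In the case of equality \<open>x\<close> is the only vertex of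
  degree above \<open>2\<close>, so \<open>G\<close> is a cycle with paths attached at \<open>x\<close>, and \<open>L\<close> determines how many
  of these paths have length one.\<close>

section \<open>Cycles with attached paths\<close>

lemma path_edges_Cons: "ys \<noteq> [] \<Longrightarrow> path_edges (x # ys) = insert {x, hd ys} (path_edges ys)"
  by (cases ys) auto

lemma path_edges_append:
  "xs \<noteq> [] \<Longrightarrow> ys \<noteq> [] \<Longrightarrow>
    path_edges (xs @ ys) = insert {last xs, hd ys} (path_edges xs \<union> path_edges ys)"
  by (induction xs rule: path_edges.induct) (auto simp: path_edges_Cons)

lemma path_edges_map: "path_edges (map f xs) = (`) f ` path_edges xs"
  by (induction xs rule: path_edges.induct) auto

lemma path_edges_subset: "e \<in> path_edges xs \<Longrightarrow> e \<subseteq> set xs"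
  by (induction xs rule: path_edges.induct) auto

lemma finite_path_edges [simp]: "finite (path_edges xs)"
  by (induction xs rule: path_edges.induct) auto

lemma card_path_edges: "distinct xs \<Longrightarrow> card (path_edges xs) = length xs - 1"
proof (induction xs rule: path_edges.induct)
  case (1 x y xs)
  then have "{x, y} \<notin> path_edges (y # xs)"
    using path_edges_subset by fastforce
  with 1 show ?case by simp
qed auto

text \<open>This local description underlies the degree counts below: distinctness keeps
  \<open>v\<close> out of every edge inside \<open>as\<close> or \<open>bs\<close>, which leaves
  only the edges to its neighbours in the list.\<close>

lemma path_edges_at:
  assumes "distinct (as @ v # bs)"
  shows "{e \<in> path_edges (as @ v # bs). v \<in> e} =
    (if as = [] then {} else {{last as, v}}) \<union> (if bs = [] then {} else {{v, hd bs}})"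
proof -
  have "v \<notin> e" if "e \<in> path_edges as \<or> e \<in> path_edges bs" for e
    using that assms path_edges_subset by fastforce
  moreover have "path_edges (as @ v # bs) =
    path_edges as \<union> path_edges bs \<union> (if as = [] then {} else {{last as, v}})
      \<union> (if bs = [] then {} else {{v, hd bs}})"
    by (cases "as = []"; cases "bs = []") (auto simp: path_edges_append path_edges_Cons)
  ultimately show ?thesis by auto
qed

section \<open>Cycles: rotation, degrees, number of edges\<close>

lemma cycle_graph_rotate: "cycle_graph (as @ bs) = cycle_graph (bs @ as)"
proof (cases "as = [] \<or> bs = []")
  case False
  then show ?thesis
    unfolding cycle_graph_def
    by (auto simp: path_edges_append simp flip: append_assoc)
qed auto

text \<open>Rotation brings any chosen vertex to the front of the list, where its two cycle edges
  can be read off.\<close>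

lemma is_cycle_from:
  assumes "is_cycle C" "v \<in> verts C"
  obtains ys where "distinct (v # ys)" "2 \<le> length ys" "C = cycle_graph (v # ys)"
proof -
  obtain xs where xs: "distinct xs" "3 \<le> length xs" "C = cycle_graph xs"
    using assms(1) unfolding is_cycle_def by blast
  with assms(2) obtain as bs where "xs = as @ v # bs"
    by (auto simp: cycle_graph_def dest: split_list)
  with xs show ?thesis
    by (intro that[of "bs @ as"]) (auto simp: cycle_graph_rotate[of as])
qed

lemma edges_cycle_graph_Cons:
  "ys \<noteq> [] \<Longrightarrow> edges (cycle_graph (v # ys)) = insert {v, hd ys} (insert {v, last ys} (path_edges ys))"
  by (auto simp: cycle_graph_def path_edges_append path_edges_Cons insert_commute
      simp flip: append_Cons)

lemma edges_cycle_graph: "xs \<noteq> [] \<Longrightarrow> edges (cycle_graph xs) = insert {last xs, hd xs} (path_edges xs)"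
  by (simp add: cycle_graph_def path_edges_append)

lemma degree_cycle:
  assumes "is_cycle C" "v \<in> verts C"
  shows "degree C v = 2"
proof -
  obtain ys where ys: "distinct (v # ys)" "2 \<le> length ys" "C = cycle_graph (v # ys)"
    using is_cycle_from[OF assms] by blast
  then have ne: "ys \<noteq> []" "hd ys \<noteq> last ys"
    by (cases ys; auto)+
  have "{e \<in> edges C. v \<in> e} = {{v, hd ys}, {v, last ys}}"
    using ys path_edges_subset[of _ ys] by (auto simp: edges_cycle_graph_Cons[OF ne(1)])
  then show ?thesis
    using ne by (simp add: degree_def doubleton_eq_iff)
qed

lemma finite_cycle: "is_cycle C \<Longrightarrow> finite (verts C) \<and> finite (edges C)"
  by (auto simp: is_cycle_def cycle_graph_def)

lemma cycle_edge_subset: "is_cycle C \<Longrightarrow> e \<in> edges C \<Longrightarrow> e \<subseteq> verts C"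
proof -
  assume "is_cycle C" and e: "e \<in> edges C"
  then obtain xs where xs: "xs \<noteq> []" "C = cycle_graph xs"
    unfolding is_cycle_def by (metis list.size(3) not_numeral_le_zero)
  with e path_edges_subset have "e \<subseteq> set (xs @ [hd xs])"
    unfolding cycle_graph_def by (metis snd_conv)
  with xs show ?thesis
    by (auto simp: cycle_graph_def)
qed

lemma card_edges_cycle:
  assumes "is_cycle C"
  shows "card (edges C) = card (verts C)"
proof -
  obtain xs where xs: "distinct xs" "3 \<le> length xs" "C = cycle_graph xs"
    using assms unfolding is_cycle_def by blast
  then obtain v ys where vys: "xs = v # ys" "ys \<noteq> []"
    by (cases xs; cases "tl xs") auto
  have hl: "hd ys \<noteq> last ys"
    using xs vys by (cases ys) auto
  have "{v, hd ys} \<notin> insert {v, last ys} (path_edges ys)" "{v, last ys} \<notin> path_edges ys"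
    using xs vys hl path_edges_subset[of _ ys] by (auto simp: doubleton_eq_iff)
  then have "card (edges C) = Suc (Suc (length ys - 1))"
    using xs vys by (simp add: edges_cycle_graph_Cons card_path_edges)
  also have "\<dots> = card (verts C)"
    using xs vys by (simp add: cycle_graph_def distinct_card)
  finally show ?thesis .
qed

lemma cycle_graph_map:
  "xs \<noteq> [] \<Longrightarrow> cycle_graph (map f xs) = (f ` verts (cycle_graph xs), (`) f ` edges (cycle_graph xs))"
  by (simp add: cycle_graph_def hd_map flip: path_edges_map)

section \<open>Paths attached at one vertex\<close>

lemma attach_paths_eq:
  "attach_paths u G ps = (verts G \<union> set (concat ps), edges G \<union> (\<Union>p\<in>set ps. path_edges (u # p)))"
  unfolding attach_paths_def
  by (induction ps arbitrary: G) (auto simp: attach_path_def)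

lemma attach_paths_map:
  "attach_paths (f u) (f ` verts G, (`) f ` edges G) (map (map f) ps) =
    (f ` verts (attach_paths u G ps), (`) f ` edges (attach_paths u G ps))"
  by (auto simp: attach_paths_eq image_Un image_UN simp flip: path_edges_map list.map(2))

text \<open>Keeps the edge sets of the cycle and of different attached paths disjoint, so that their
  cardinalities add up.\<close>

lemma path_edges_Cons_meets: "e \<in> path_edges (u # p) \<Longrightarrow> e \<inter> set p \<noteq> {}"
  by (induction p arbitrary: u) auto

lemma card_star_edges:
  assumes "distinct (concat ps)" "u \<notin> set (concat ps)"
  shows "card (\<Union>p\<in>set ps. path_edges (u # p)) = length (concat ps)"
  using assms
proof (induction ps)
  case (Cons p ps)
  have "path_edges (u # p) \<inter> (\<Union>q\<in>set ps. path_edges (u # q)) = {}"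
  proof (rule ccontr)
    assume "\<not> ?thesis"
    then obtain e q where e: "e \<in> path_edges (u # p)" "q \<in> set ps" "e \<in> path_edges (u # q)"
      by blast
    then obtain v where "v \<in> e" "v \<in> set p"
      using path_edges_Cons_meets[OF e(1)] by blast
    then have "v = u \<or> v \<in> set q"
      using path_edges_subset[OF e(3)] by auto
    with e \<open>v \<in> set p\<close> Cons.prems show False by auto
  qed
  with Cons show ?case
    by (simp add: card_Un_disjoint card_path_edges)
qed simp

text \<open>Common frame for both extremal families: unlike in \<open>cycle_with_long_paths\<close>,
  paths of length one are allowed, but empty ones are excluded so that \<open>length ps\<close>
  counts the additional edges at \<open>u\<close>.\<close>

locale cycle_with_paths =
  fixes C :: "'a graph" and u :: 'a and ps :: "'a list list"
  assumes cycle: "is_cycle C" and root: "u \<in> verts C"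
    and nonempty: "\<And>p. p \<in> set ps \<Longrightarrow> p \<noteq> []"
    and distinct: "distinct (concat ps)" and disjoint: "set (concat ps) \<inter> verts C = {}"
begin

abbreviation G where "G \<equiv> attach_paths u C ps"

lemma root_notin: "u \<notin> set (concat ps)"
  using root disjoint by blast

lemma distinct_paths: "distinct ps"
proof -
  \<comment> \<open>\<open>distinct_concat_iff\<close> speaks of the list without its empty
    members.\<close>
  have "removeAll [] ps = ps"
    using nonempty by (intro removeAll_id) blast
  then show ?thesis
    using distinct by (simp add: distinct_concat_iff)
qed

lemma distinct_path: "p \<in> set ps \<Longrightarrow> distinct p"
  using distinct by (auto simp: distinct_concat_iff)

lemma path_unique: "p \<in> set ps \<Longrightarrow> q \<in> set ps \<Longrightarrow> v \<in> set p \<Longrightarrow> v \<in> set q \<Longrightarrow> p = q"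
  using distinct by (auto simp: distinct_concat_iff)

lemma card_verts: "card (verts G) = card (verts C) + length (concat ps)"
proof -
  have "card (set (concat ps)) = length (concat ps)"
    using distinct by (rule distinct_card)
  moreover have "card (verts C \<union> set (concat ps)) = card (verts C) + card (set (concat ps))"
    using disjoint finite_cycle[OF cycle] by (intro card_Un_disjoint) auto
  ultimately show ?thesis
    by (simp only: attach_paths_eq fst_conv)
qed

text \<open>A path attached to \<open>u\<close> brings one edge for each new vertex, and a cycle has
  equally many of both.\<close>

lemma card_edges: "card (edges G) = card (verts G)"
proof -
  have "edges C \<inter> (\<Union>p\<in>set ps. path_edges (u # p)) = {}"
    using path_edges_Cons_meets cycle_edge_subset[OF cycle] disjoint by fastforce
  then show ?thesis
    using finite_cycle[OF cycle] card_star_edges[OF distinct root_notin] card_edges_cycle[OF cycle]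
    unfolding card_verts by (simp add: attach_paths_eq card_Un_disjoint)
qed

lemma degree_root: "degree G u = 2 + length ps"
proof -
  have at: "{e \<in> path_edges (u # p). u \<in> e} = {{u, hd p}}" if "p \<in> set ps" for p
  proof -
    have "distinct ([] @ u # p)"
      using distinct_path[OF that] that root_notin by auto
    from path_edges_at[OF this] nonempty[OF that] show ?thesis by simp
  qed
  have "{e \<in> edges G. u \<in> e} = {e \<in> edges C. u \<in> e} \<union> (\<Union>p\<in>set ps. {e \<in> path_edges (u # p). u \<in> e})"
    by (auto simp: attach_paths_eq)
  also have "\<dots> = {e \<in> edges C. u \<in> e} \<union> (\<lambda>p. {u, hd p}) ` set ps"
    using at by auto
  finally have eq: "{e \<in> edges G. u \<in> e} = \<dots>" .
  have hd: "hd p \<in> set (concat ps)" if "p \<in> set ps" for p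
    using nonempty[OF that] that by (auto intro!: bexI[of _ p])
  then have "{e \<in> edges C. u \<in> e} \<inter> (\<lambda>p. {u, hd p}) ` set ps = {}"
    using cycle_edge_subset[OF cycle] disjoint by fastforce
  moreover have "inj_on (\<lambda>p. {u, hd p}) (set ps)"
    using hd root_notin path_unique nonempty
    by (intro inj_onI) (metis doubleton_eq_iff hd_in_set)
  ultimately show ?thesis
    using eq degree_cycle[OF cycle root] finite_cycle[OF cycle] distinct_paths
    by (simp add: degree_def card_Un_disjoint card_image distinct_card)
qed

lemma degree_cycle_vertex:
  assumes "v \<in> verts C" "v \<noteq> u"
  shows "degree G v = 2"
proof -
  have "v \<notin> e" if "p \<in> set ps" "e \<in> path_edges (u # p)" for p e
    using path_edges_subset[OF that(2)] that(1) assms disjoint by auto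
  then have "{e \<in> edges G. v \<in> e} = {e \<in> edges C. v \<in> e}"
    by (auto simp: attach_paths_eq)
  then show ?thesis
    using degree_cycle[OF cycle assms(1)] by (simp add: degree_def)
qed

lemma degree_path_vertex:
  assumes "p \<in> set ps" "v \<in> set p"
  shows "degree G v = (if v = last p then 1 else 2)"
proof -
  obtain as bs where p: "p = as @ v # bs"
    using assms(2) by (auto dest: split_list)
  \<comment> \<open>With \<open>u\<close> in front, \<open>v\<close> always has a predecessor; only
    the existence of a successor depends on whether \<open>v\<close> ends the path.\<close>
  have d: "distinct ((u # as) @ v # bs)"
    using distinct_path[OF assms(1)] assms(1) root_notin p by auto
  have "v \<notin> e" if "e \<in> edges C" for e
    using that assms disjoint cycle_edge_subset[OF cycle that] by auto
  moreover have "q = p" if "q \<in> set ps" "e \<in> path_edges (u # q)" "v \<in> e" for q e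
    using path_edges_subset[OF that(2)] that assms path_unique root_notin by auto
  ultimately have "{e \<in> edges G. v \<in> e} = {e \<in> path_edges ((u # as) @ v # bs). v \<in> e}"
    using assms(1) p by (auto simp: attach_paths_eq)
  also have "\<dots> = {{last (u # as), v}} \<union> (if bs = [] then {} else {{v, hd bs}})"
    unfolding path_edges_at[OF d] by simp
  finally have eq: "{e \<in> edges G. v \<in> e} = \<dots>" .
  show ?thesis
  proof (cases "bs = []")
    case True
    then show ?thesis using eq p by (simp add: degree_def)
  next
    case False
    then have hb: "hd bs \<in> set bs" "last bs \<in> set bs" by auto
    moreover have "last (u # as) \<in> set (u # as)" by (rule last_in_set) simp
    ultimately have "last (u # as) \<noteq> hd bs" "v \<noteq> last bs"
      using d by (metis distinct_append disjoint_iff insert_iff list.simps(15) last_in_set, auto)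
    then show ?thesis
      using eq p False by (auto simp: degree_def doubleton_eq_iff)
  qed
qed

lemma verts_cases:
  assumes "v \<in> verts G"
  obtains "v = u" | "v \<in> verts C" "v \<noteq> u" | p where "p \<in> set ps" "v \<in> set p"
  using assms by (auto simp: attach_paths_eq)

lemma degree_le_2: "v \<in> verts G \<Longrightarrow> v \<noteq> u \<Longrightarrow> degree G v \<le> 2"
  by (erule verts_cases) (auto simp: degree_cycle_vertex degree_path_vertex)

text \<open>Degree 1 makes \<open>v\<close> the last vertex of its path, and adjacency to
  \<open>u\<close> makes it the first. So pendant neighbours of the root correspond to paths of
  length one.\<close>

lemma pendant_neighbours:
  "{v \<in> verts G. {v, u} \<in> edges G \<and> degree G v = 1} = hd ` set (filter (\<lambda>p. length p = 1) ps)"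
proof (intro equalityI subsetI)
  fix v assume "v \<in> {v \<in> verts G. {v, u} \<in> edges G \<and> degree G v = 1}"
  then have v: "v \<in> verts G" "{v, u} \<in> edges G" "degree G v = 1" by auto
  have "v \<noteq> u" using v(3) degree_root by auto
  with v obtain p where p: "p \<in> set ps" "v \<in> set p"
    using verts_cases[OF v(1)] degree_cycle_vertex by (metis numeral_eq_one_iff semiring_norm(85))
  then have "v = last p"
    using v(3) degree_path_vertex by (metis numeral_eq_one_iff semiring_norm(85))
  have "v \<notin> verts C" using p disjoint by auto
  then have "{v, u} \<notin> edges C"
    using cycle_edge_subset[OF cycle] by blast
  then obtain q where q: "q \<in> set ps" "{v, u} \<in> path_edges (u # q)"
    using v(2) by (auto simp: attach_paths_eq)
  then have "v \<in> set q"
    using path_edges_subset[OF q(2)] \<open>v \<noteq> u\<close> by auto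
  then have "q = p" using p q path_unique by blast
  have "u \<notin> set p" using p root_notin by auto
  then have "{v, u} \<notin> path_edges p"
    using path_edges_subset[of _ p] by blast
  then have "v = hd p"
    using q(2) \<open>q = p\<close> nonempty[OF p(1)] \<open>v \<noteq> u\<close> by (auto simp: path_edges_Cons doubleton_eq_iff)
  moreover have "distinct p"
    using p distinct by (auto simp: distinct_concat_iff)
  ultimately have "length p = 1"
    using \<open>v = last p\<close> nonempty[OF p(1)] by (cases p) (auto split: if_splits)
  then show "v \<in> hd ` set (filter (\<lambda>p. length p = 1) ps)"
    using \<open>v = hd p\<close> p by auto
next
  fix v assume "v \<in> hd ` set (filter (\<lambda>p. length p = 1) ps)"
  then have p: "[v] \<in> set ps"
    by (auto simp: length_Suc_conv)
  then show "v \<in> {v \<in> verts G. {v, u} \<in> edges G \<and> degree G v = 1}"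
    using degree_path_vertex[OF p, of v] by (force simp: attach_paths_eq)
qed

lemma card_pendant_neighbours:
  "card {v \<in> verts G. {v, u} \<in> edges G \<and> degree G v = 1} = length (filter (\<lambda>p. length p = 1) ps)"
proof -
  have "inj_on hd (set (filter (\<lambda>p. length p = 1) ps))"
    by (intro inj_onI) (auto simp: length_Suc_conv)
  then show ?thesis
    unfolding pendant_neighbours using distinct_card[of "filter (\<lambda>p. length p = 1) ps"]
    by (simp add: card_image distinct_paths)
qed

end

section \<open>Unicyclic graphs\<close>

lemma simple_graph_finite: "simple_graph G \<Longrightarrow> finite (verts G) \<and> finite (edges G)"
  unfolding simple_graph_def by (meson finite_Pow_iff finite_subset PowI subsetI)

lemma simple_graph_edgeE:
  assumes "simple_graph G" "e \<in> edges G"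
  obtains a b where "e = {a, b}" "a \<noteq> b" "a \<in> verts G" "b \<in> verts G"
proof -
  have "card e = 2" "e \<subseteq> verts G"
    using assms unfolding simple_graph_def by auto
  then obtain a b where "e = {a, b}" "a \<noteq> b"
    by (meson card_2_iff)
  then show ?thesis
    using that \<open>e \<subseteq> verts G\<close> by auto
qed

text \<open>A walk from \<open>W\<close> to its complement has to leave \<open>W\<close> along some
  edge. The maximality arguments below enlarge a partial subgraph by such an edge.\<close>

lemma crossing_edge:
  assumes "simple_graph G" "graph_connected G" "W \<subseteq> verts G" "W \<noteq> {}" "W \<noteq> verts G"
  obtains a b where "a \<in> W" "b \<in> verts G" "b \<notin> W" "{a, b} \<in> edges G"
proof -
  obtain s t where st: "s \<in> W" "t \<in> verts G" "t \<notin> W"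
    using assms by blast
  then have "(s, t) \<in> {(x, y). {x, y} \<in> edges G}\<^sup>*"
    using assms(2,3) unfolding graph_connected_def by blast
  then have "t \<notin> W \<Longrightarrow> \<exists>a b. a \<in> W \<and> b \<notin> W \<and> {a, b} \<in> edges G"
  proof induction
    case base
    with st show ?case by blast
  next
    case (step y z)
    then show ?case by (cases "y \<in> W") blast+
  qed
  with st(3) obtain a b where "a \<in> W" "b \<notin> W" "{a, b} \<in> edges G"
    by blast
  moreover from this(3) have "b \<in> verts G"
    using assms(1) unfolding simple_graph_def by blast
  ultimately show ?thesis
    using that by blast
qed

lemma reachable_path:
  assumes "(u, v) \<in> {(x, y). {x, y} \<in> F}\<^sup>*"
  obtains p where "distinct p" "p \<noteq> []" "hd p = u" "last p = v" "path_edges p \<subseteq> F"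
proof -
  from assms have "\<exists>p. distinct p \<and> p \<noteq> [] \<and> hd p = u \<and> last p = v \<and> path_edges p \<subseteq> F"
  proof induction
    case base
    show ?case by (rule exI[of _ "[u]"]) simp
  next
    case (step y z)
    then obtain p where p: "distinct p" "p \<noteq> []" "hd p = u" "last p = y" "path_edges p \<subseteq> F"
      by blast
    show ?case
    proof (cases "z \<in> set p")
      \<comment> \<open>The walk returns to a vertex of the path, so the path is cut off
        there.\<close>
      case True
      then obtain as bs where "p = as @ z # bs"
        by (auto dest: split_list)
      moreover have "path_edges (as @ [z]) \<subseteq> path_edges ((as @ [z]) @ bs)"
        using path_edges_append[of "as @ [z]" bs] by (cases "bs = []") auto
      ultimately show ?thesis
        using p by (intro exI[of _ "as @ [z]"]) (auto simp: hd_append split: if_splits)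
    next
      case False
      then show ?thesis
        using p step.hyps by (intro exI[of _ "p @ [z]"]) (auto simp: path_edges_append)
    qed
  qed
  then show ?thesis using that by blast
qed

lemma path_reachable: "v \<in> set xs \<Longrightarrow> (hd xs, v) \<in> {(x, y). {x, y} \<in> path_edges xs}\<^sup>*"
proof (induction xs rule: path_edges.induct)
  case (1 x y xs)
  show ?case
  proof (cases "v = x")
    case False
    with 1 have "(y, v) \<in> {(a, b). {a, b} \<in> path_edges (y # xs)}\<^sup>*"
      by simp
    then have "(y, v) \<in> {(a, b). {a, b} \<in> path_edges (x # y # xs)}\<^sup>*"
      by (rule rtrancl_mono[THEN subsetD, rotated]) auto
    then show ?thesis
      by (auto intro: converse_rtrancl_into_rtrancl)
  qed simp
qed auto

text \<open>Used to place a path in \<open>verts G\<close> once its edges lie in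
  \<open>edges G\<close>; a single vertex has no edges, hence the lower bound 2.\<close>

lemma path_covered: "2 \<le> length p \<Longrightarrow> set p \<subseteq> \<Union> (path_edges p)"
proof (induction p rule: path_edges.induct)
  case (1 x y xs)
  then show ?case by (cases xs) auto
qed auto

text \<open>An edge \<open>{u, v}\<close> outside a connected part that contains \<open>C\<close> closes a cycle other than \<open>C\<close>.\<close>

lemma no_extra_edge:
  assumes G: "unicyclic G" and C: "is_cycle C" "subgraph C G"
    and F: "edges C \<subseteq> F" "F \<subseteq> edges G" and reach: "(u, v) \<in> {(x, y). {x, y} \<in> F}\<^sup>*"
    and e: "{u, v} \<in> edges G"
  shows "{u, v} \<in> F"
proof (rule ccontr)
  assume notF: "{u, v} \<notin> F"
  have simple: "simple_graph G"
    using G unfolding unicyclic_def by blast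
  then have "u \<noteq> v"
    using e unfolding simple_graph_def by force
  obtain p where p: "distinct p" "p \<noteq> []" "hd p = u" "last p = v" "path_edges p \<subseteq> F"
    using reachable_path[OF reach] by blast
  have "3 \<le> length p"
  proof (rule ccontr)
    assume "\<not> ?thesis"
    then have "length p = 1 \<or> length p = 2"
      using p(2) length_0_conv[of p] by linarith
    then show False
      using p \<open>u \<noteq> v\<close> notF by (auto simp: length_Suc_conv numeral_2_eq_2)
  qed
  have eq: "edges (cycle_graph p) = insert {u, v} (path_edges p)"
    using p by (simp add: edges_cycle_graph insert_commute)
  have cyc: "is_cycle (cycle_graph p)"
    using p(1) \<open>3 \<le> length p\<close> unfolding is_cycle_def by blast
  have sub: "edges (cycle_graph p) \<subseteq> edges G"
    using eq p(5) F(2) e by auto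
  have "set p \<subseteq> verts G"
  proof -
    have "set p \<subseteq> \<Union> (path_edges p)"
      using \<open>3 \<le> length p\<close> by (intro path_covered) simp
    also have "\<dots> \<subseteq> \<Union> (edges G)"
      using eq sub by blast
    also have "\<dots> \<subseteq> verts G"
      using simple unfolding simple_graph_def by blast
    finally show ?thesis .
  qed
  then have "subgraph (cycle_graph p) G"
    using sub unfolding subgraph_def by (simp add: cycle_graph_def)
  \<comment> \<open>Uniqueness identifies the new cycle with \<open>C\<close>, although it has the
    edge \<open>{u, v}\<close> outside \<open>F\<close>.\<close>
  then have "cycle_graph p = C"
    using cyc C G unfolding unicyclic_def by blast
  then show False
    using eq F(1) notF by auto
qed

text \<open>Grow a connected subgraph from the cycle, which has as many edges as vertices: each
  crossing edge adds one of both. A subgraph of this kind with the most vertices spans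
  \<open>G\<close>, and \<open>no_extra_edge\<close> leaves no edge of \<open>G\<close> outside
  it.\<close>

lemma unicyclic_card_edges:
  assumes "unicyclic G"
  shows "card (edges G) = card (verts G)"
proof -
  have simple: "simple_graph G" and conn: "graph_connected G"
    using assms unfolding unicyclic_def by auto
  note fin = simple_graph_finite[OF simple]
  obtain C where C: "is_cycle C" "subgraph C G"
    using assms unfolding unicyclic_def by blast
  then obtain xs where xs: "xs \<noteq> []" "C = cycle_graph xs"
    unfolding is_cycle_def by (metis list.size(3) not_numeral_le_zero)
  define c where "c = hd xs"
  \<comment> \<open>Reachability from \<open>c\<close> is required along edges of the subgraph
    itself, as \<open>no_extra_edge\<close> demands.\<close>
  define P where "P = (\<lambda>(W, F). verts C \<subseteq> W \<and> W \<subseteq> verts G \<and> edges C \<subseteq> F \<and> F \<subseteq> edges G \<and>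
      (\<forall>e\<in>F. e \<subseteq> W) \<and> card F = card W \<and> (\<forall>v\<in>W. (c, v) \<in> {(x, y). {x, y} \<in> F}\<^sup>*))"
  have "(c, v) \<in> {(x, y). {x, y} \<in> edges C}\<^sup>*" if "v \<in> verts C" for v
  proof -
    have "(c, v) \<in> {(x, y). {x, y} \<in> path_edges xs}\<^sup>*"
      unfolding c_def using that xs by (intro path_reachable) (simp add: cycle_graph_def)
    then show ?thesis
      by (rule rtrancl_mono[THEN subsetD, rotated]) (auto simp: xs edges_cycle_graph)
  qed
  then have "P C"
    using C cycle_edge_subset[OF C(1)] card_edges_cycle[OF C(1)]
    by (cases C) (auto simp: P_def subgraph_def)
  moreover have "\<forall>H. P H \<longrightarrow> card (verts H) < Suc (card (verts G))"
    using fin by (auto simp: P_def less_Suc_eq_le intro!: card_mono)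
  ultimately obtain H where "P H" and max: "\<And>H'. P H' \<Longrightarrow> card (verts H') \<le> card (verts H)"
    using ex_has_greatest_nat[of P C "\<lambda>H. card (verts H)" "Suc (card (verts G))"] by metis
  obtain W F where H: "H = (W, F)" by (cases H)
  have WF: "verts C \<subseteq> W" "W \<subseteq> verts G" "edges C \<subseteq> F" "F \<subseteq> edges G" "\<forall>e\<in>F. e \<subseteq> W"
    "card F = card W" "\<And>v. v \<in> W \<Longrightarrow> (c, v) \<in> {(x, y). {x, y} \<in> F}\<^sup>*"
    using \<open>P H\<close> unfolding H P_def by auto
  have finWF: "finite W" "finite F"
    using WF(2,4) fin finite_subset by auto
  have "W = verts G"
  proof (rule ccontr)
    assume "W \<noteq> verts G"
    moreover have "W \<noteq> {}"
      using WF(1) xs by (auto simp: cycle_graph_def)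
    ultimately obtain a b where ab: "a \<in> W" "b \<in> verts G" "b \<notin> W" "{a, b} \<in> edges G"
      using crossing_edge[OF simple conn WF(2)] by blast
    have "(c, v) \<in> {(x, y). {x, y} \<in> insert {a, b} F}\<^sup>*" if "v \<in> W" for v
      using WF(7)[OF that] by (rule rtrancl_mono[THEN subsetD, rotated]) auto
    moreover from this[OF ab(1)] have "(c, b) \<in> {(x, y). {x, y} \<in> insert {a, b} F}\<^sup>*"
      by (rule rtrancl_into_rtrancl) auto
    moreover have "{a, b} \<notin> F"
      using ab WF(5) by blast
    ultimately have "P (insert b W, insert {a, b} F)"
      using WF ab finWF by (auto simp: P_def)
    from max[OF this] show False
      using ab finWF by (simp add: H)
  qed
  have "edges G \<subseteq> F"
  proof
    fix e assume e: "e \<in> edges G"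
    then obtain u v where uv: "e = {u, v}" "u \<in> W" "v \<in> W"
      using simple_graph_edgeE[OF simple e] \<open>W = verts G\<close> by metis
    have "sym {(x, y). {x, y} \<in> F}"
      by (auto simp: sym_def insert_commute)
    then have "(u, c) \<in> {(x, y). {x, y} \<in> F}\<^sup>*"
      using WF(7)[OF uv(2)] sym_rtrancl by (metis symD)
    then have "(u, v) \<in> {(x, y). {x, y} \<in> F}\<^sup>*"
      using WF(7)[OF uv(3)] by (rule rtrancl_trans)
    then show "e \<in> F"
      using no_extra_edge[OF assms C WF(3,4)] e uv(1) by blast
  qed
  then show ?thesis
    using WF(4,6) \<open>W = verts G\<close> by (metis subset_antisym)
qed

section \<open>Unicyclic graphs with at most one vertex of degree above 2\<close>

lemma degree_subgraph_less:
  assumes "simple_graph G" "subgraph H G" "e \<in> edges G" "e \<notin> edges H" "v \<in> e"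
  shows "degree H v < degree G v"
  unfolding degree_def
  using assms simple_graph_finite[of G] by (intro psubset_card_mono) (auto simp: subgraph_def)

text \<open>An edge leaving the cycle would give its end on the cycle a third incident edge.\<close>

lemma cycle_spanning:
  assumes "simple_graph G" "graph_connected G" "is_cycle C" "subgraph C G"
    "\<And>v. v \<in> verts C \<Longrightarrow> degree G v \<le> 2"
  shows "verts C = verts G"
proof (rule ccontr)
  assume "verts C \<noteq> verts G"
  moreover have "verts C \<subseteq> verts G" "verts C \<noteq> {}"
    using assms(3,4) by (auto simp: subgraph_def is_cycle_def cycle_graph_def)
  ultimately obtain a b where ab: "a \<in> verts C" "b \<notin> verts C" "{a, b} \<in> edges G"
    using crossing_edge[OF assms(1,2)] by metis
  then have "{a, b} \<notin> edges C"
    using cycle_edge_subset[OF assms(3)] by blast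
  then have "degree C a < degree G a"
    using ab(3) by (intro degree_subgraph_less[OF assms(1,4), of "{a, b}"]) auto
  then show False
    using assms(5)[OF ab(1)] degree_cycle[OF assms(3) ab(1)] by simp
qed

text \<open>Attach at \<open>x\<close> paths of maximal total length inside \<open>G\<close>. An
  edge leaving this subgraph would start at \<open>x\<close> and begin a new path, start at the end
  of a path and extend it, or start at a vertex that already has degree 2. None is possible, so the
  subgraph spans \<open>G\<close>.\<close>

lemma unicyclic_eq_cycle_with_paths:
  assumes G: "unicyclic G" and x: "x \<in> verts G"
    and deg: "\<And>v. v \<in> verts G \<Longrightarrow> v \<noteq> x \<Longrightarrow> degree G v \<le> 2"
  obtains C ps where "cycle_with_paths C x ps" "G = attach_paths x C ps"
proof -
  have simple: "simple_graph G" and conn: "graph_connected G"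
    using G unfolding unicyclic_def by auto
  note fin = simple_graph_finite[OF simple]
  obtain C where C: "is_cycle C" "subgraph C G"
    using G unfolding unicyclic_def by blast
  \<comment> \<open>If \<open>x\<close> were off the cycle, all cycle vertices would have degree at
    most 2, and the cycle would span \<open>G\<close>.\<close>
  have xC: "x \<in> verts C"
  proof (rule ccontr)
    assume "x \<notin> verts C"
    then have "degree G v \<le> 2" if "v \<in> verts C" for v
      using that C(2) by (intro deg) (auto simp: subgraph_def)
    then show False
      using cycle_spanning[OF simple conn C] x \<open>x \<notin> verts C\<close> by blast
  qed
  define P where "P ps \<longleftrightarrow> cycle_with_paths C x ps \<and> subgraph (attach_paths x C ps) G" for ps
  have "P []"
    using C xC by (auto simp: P_def attach_paths_def intro!: cycle_with_paths.intro)
  moreover have "\<forall>ps. P ps \<longrightarrow> length (concat ps) < Suc (card (verts G))"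
  proof (intro allI impI)
    fix ps assume "P ps"
    then have "card (verts (attach_paths x C ps)) \<le> card (verts G)"
      using fin by (auto simp: P_def subgraph_def intro: card_mono)
    then show "length (concat ps) < Suc (card (verts G))"
      using \<open>P ps\<close> cycle_with_paths.card_verts[of C x ps] by (simp add: P_def)
  qed
  ultimately obtain ps where "P ps" and max: "\<And>qs. P qs \<Longrightarrow> length (concat qs) \<le> length (concat ps)"
    using ex_has_greatest_nat[of P "[]" "\<lambda>ps. length (concat ps)" "Suc (card (verts G))"] by metis
  interpret cycle_with_paths C x ps
    using \<open>P ps\<close> by (simp add: P_def)
  let ?H = "attach_paths x C ps"
  have sub: "subgraph ?H G"
    using \<open>P ps\<close> by (simp add: P_def)
  have edgeH: "e \<subseteq> verts ?H" if "e \<in> edges ?H" for e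
    using that cycle_edge_subset[OF cycle] root path_edges_subset
    by (fastforce simp: attach_paths_eq)
  have "verts ?H = verts G"
  proof (rule ccontr)
    assume "verts ?H \<noteq> verts G"
    moreover have "verts ?H \<subseteq> verts G" "verts ?H \<noteq> {}"
      using sub root by (auto simp: subgraph_def attach_paths_eq)
    ultimately obtain a b where ab: "a \<in> verts ?H" "b \<in> verts G" "b \<notin> verts ?H" "{a, b} \<in> edges G"
      using crossing_edge[OF simple conn] by metis
    then have "{a, b} \<notin> edges ?H"
      using edgeH by blast
    then have less: "degree ?H a < degree G a"
      using ab(4) by (intro degree_subgraph_less[OF simple sub, of "{a, b}"]) auto
    have new: "b \<notin> verts C" "b \<notin> set (concat ps)"
      using ab(3) by (auto simp: attach_paths_eq)
    have aG: "a \<in> verts G"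
      using ab(1) sub by (auto simp: subgraph_def)
    from ab(1) show False
    proof (cases rule: verts_cases)
      case 1
      have "cycle_with_paths C x ([b] # ps)"
        using cycle root nonempty distinct disjoint new by unfold_locales auto
      moreover have "subgraph (attach_paths x C ([b] # ps)) G"
        using sub ab 1 by (auto simp: subgraph_def attach_paths_eq)
      ultimately show False
        using max[of "[b] # ps"] by (simp add: P_def)
    next
      case 2
      then show False
        using less degree_cycle_vertex deg[OF aG] by simp
    next
      case (3 p)
      have "a \<noteq> x"
        using 3 root_notin by auto
      then have "a = last p"
        using less degree_path_vertex[OF 3] deg[OF aG] by (auto split: if_splits)
      obtain qs rs where ps: "ps = qs @ p # rs"
        using 3(1) by (auto dest: split_list)
      let ?ps = "qs @ (p @ [b]) # rs"
      have "p \<noteq> []" using 3 by auto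
      have "cycle_with_paths C x ?ps"
        using cycle root nonempty distinct disjoint new by unfold_locales (auto simp: ps)
      moreover have "path_edges (x # p @ [b]) = insert {a, b} (path_edges (x # p))"
        using path_edges_append[of "x # p" "[b]"] \<open>p \<noteq> []\<close> \<open>a = last p\<close> by simp
      then have "subgraph (attach_paths x C ?ps) G"
        using sub ab by (auto simp: subgraph_def attach_paths_eq ps)
      ultimately show False
        using max[of ?ps] by (simp add: P_def ps)
    qed
  qed
  \<comment> \<open>Both graphs have as many edges as vertices, and their vertices agree.\<close>
  moreover from this have "edges ?H = edges G"
    using sub fin unicyclic_card_edges[OF G] card_edges
    by (intro card_subset_eq) (auto simp: subgraph_def)
  ultimately show ?thesis
    using that cycle_with_paths_axioms by (metis prod.collapse)
qed

section \<open>Splitting the edge weights\<close>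

text \<open>Rationalising turns the difference at \<open>r\<close> into the reciprocal of
  \<open>sqrt r * sqrt (r + 1) * (sqrt r + sqrt (r + 1))\<close>, a product that increases with
  \<open>r\<close>.\<close>

lemma inverse_sqrt_diff_strict_antimono:
  fixes s t :: real
  assumes "0 < s" "s < t"
  shows "1 / sqrt t - 1 / sqrt (t + 1) < 1 / sqrt s - 1 / sqrt (s + 1)"
proof -
  have eq: "1 / sqrt r - 1 / sqrt (r + 1) = 1 / (sqrt r * sqrt (r + 1) * (sqrt r + sqrt (r + 1)))"
    if "0 < r" for r :: real
  proof -
    define p q where "p = sqrt r" and "q = sqrt (r + 1)"
    have "0 < p" "0 < q" "q\<^sup>2 = p\<^sup>2 + 1"
      using that by (auto simp: p_def q_def)
    then have "1 / p - 1 / q = (q - p) / (p * q)"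
      by (simp add: diff_frac_eq)
    also have "\<dots> = (q - p) * (q + p) / (p * q * (p + q))"
      using \<open>0 < p\<close> \<open>0 < q\<close> by (simp add: add.commute)
    also have "(q - p) * (q + p) = 1"
      using \<open>q\<^sup>2 = p\<^sup>2 + 1\<close> by (simp add: algebra_simps power2_eq_square)
    finally show ?thesis
      by (simp add: p_def q_def)
  qed
  have "sqrt s * sqrt (s + 1) * (sqrt s + sqrt (s + 1)) < sqrt t * sqrt (t + 1) * (sqrt t + sqrt (t + 1))"
    using assms by (intro mult_strict_mono add_strict_mono) (auto intro!: mult_pos_pos add_pos_pos)
  then show ?thesis
    using assms by (simp only: eq) (intro divide_strict_left_mono mult_pos_pos add_pos_pos, auto)
qed

text \<open>Midpoint convexity of \<open>1 / sqrt t\<close> at \<open>2 * a\<close> and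
  \<open>2 * b\<close>. With \<open>p\<close> and \<open>q\<close> for the two roots, the mean of
  \<open>p\<close> and \<open>q\<close> is at most their quadratic mean \<open>sqrt (a + b)\<close>,
  and its reciprocal is at most the mean of the reciprocals.\<close>

lemma inverse_sqrt_midpoint:
  fixes a b :: real
  assumes "0 < a" "0 < b"
  shows "1 / sqrt (a + b) \<le> 1 / (2 * sqrt (2 * a)) + 1 / (2 * sqrt (2 * b))"
proof -
  define p q where "p = sqrt (2 * a)" and "q = sqrt (2 * b)"
  have pq: "0 < p" "0 < q" "p\<^sup>2 = 2 * a" "q\<^sup>2 = 2 * b"
    using assms by (auto simp: p_def q_def)
  have sq: "0 \<le> (p - q)\<^sup>2" by simp
  have "((p + q) / 2)\<^sup>2 \<le> a + b"
    using sq pq by (simp add: power2_eq_square field_simps)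
  then have "(p + q) / 2 \<le> sqrt (a + b)"
    by (rule real_le_rsqrt)
  then have "1 / sqrt (a + b) \<le> 1 / ((p + q) / 2)"
    using pq by (intro divide_left_mono) (auto intro!: mult_pos_pos add_pos_pos assms)
  also have "\<dots> \<le> 1 / (2 * p) + 1 / (2 * q)"
  proof -
    have "4 * (p * q) \<le> (p + q)\<^sup>2"
      using sq by (simp add: power2_eq_square algebra_simps)
    then show ?thesis
      using pq by (simp add: divide_simps power2_eq_square add.commute)
  qed
  finally show ?thesis
    by (simp add: p_def q_def)
qed

text \<open>The weights \<open>1 / \<surd>(a + b)\<close> of the edges with end degrees \<open>(1, 2)\<close> and \<open>(2, 2)\<close> split exactly
  into potentials of their ends.\<close>

definition potential :: "nat \<Rightarrow> real" where
  "potential d = (if d = 1 then 1 / sqrt 3 - 1 / 4 else 1 / (2 * sqrt (2 * real d)))"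

text \<open>For degrees at least 2 this is midpoint convexity. At an edge with a pendant end,
  replacing the degree 1 by 2 lowers the weight most when \<open>b = 2\<close>, and
  \<open>potential 1\<close> exceeds \<open>potential 2\<close> by exactly that drop. Two pendant
  ends are excluded because \<open>1 / sqrt 2\<close> is larger than
  \<open>2 * potential 1\<close>.\<close>

lemma edge_weight_le_potential:
  assumes "1 \<le> a" "1 \<le> b" "a \<noteq> 1 \<or> b \<noteq> 1"
  shows "1 / sqrt (real a + real b) \<le> potential a + potential b"
proof -
  have one: "1 / sqrt (1 + real b) \<le> potential 1 + potential b" if "2 \<le> b" for b
  proof (cases "b = 2")
    case False
    have "1 / sqrt (real b + 1) - 1 / sqrt (real b + 1 + 1) < 1 / sqrt 3 - 1 / sqrt (3 + 1)"
      using that False by (intro inverse_sqrt_diff_strict_antimono) auto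
    moreover have "1 / sqrt (2 + real b) \<le> 1 / (2 * sqrt (2 * 2)) + 1 / (2 * sqrt (2 * real b))"
      using that by (intro inverse_sqrt_midpoint) auto
    ultimately show ?thesis
      using that by (simp add: potential_def add.commute)
  qed (simp add: potential_def)
  consider "a = 1" "2 \<le> b" | "b = 1" "2 \<le> a" | "2 \<le> a" "2 \<le> b"
    using assms by linarith
  then show ?thesis
  proof cases
    case 1
    then show ?thesis using one[of b] by simp
  next
    case 2
    then show ?thesis using one[of a] by (simp add: add.commute)
  next
    case 3
    then show ?thesis
      using inverse_sqrt_midpoint[of "real a" "real b"] by (simp add: potential_def)
  qed
qed

lemma edge_weight_eq_potential:
  assumes "1 \<le> a" "1 \<le> b" "a \<noteq> 1 \<or> b \<noteq> 1" "a \<le> 2" "b \<le> 2"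
  shows "1 / sqrt (real a + real b) = potential a + potential b"
proof -
  have "a = 1 \<and> b = 2 \<or> a = 2 \<and> b = 1 \<or> a = 2 \<and> b = 2"
    using assms by linarith
  then show ?thesis by (auto simp: potential_def)
qed

text \<open>The left side bounds the share of a neighbour of \<open>x\<close> of degree
  \<open>d\<close>, and the right side is the affine bound, so a branching vertex stays strictly
  below it. With \<open>potential d \<le> 1 / 4\<close> the same estimate covers vertices not
  adjacent to \<open>x\<close>.\<close>

lemma potential_branch_less:
  assumes "3 \<le> d"
  shows "(real d - 1) * potential d + 1 / 4 < 2 / sqrt 3 - 1 + (3 / 4 - 1 / sqrt 3) * real d"
    and "potential d \<le> 1 / 4"
proof -
  have "1.732 \<le> sqrt (3 :: real)"
    by (rule real_le_rsqrt) (simp add: power2_eq_square)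
  then have "1 / sqrt 3 \<le> 1 / (1.732 :: real)"
    by (intro divide_left_mono) auto
  then have k: "1 / sqrt 3 \<le> (5774 / 10000 :: real)"
    by simp
  have pot: "potential d \<le> 1 / (2 * c)" if "0 < c" "c\<^sup>2 \<le> 2 * real d" for c
  proof -
    have "c \<le> sqrt (2 * real d)"
      using that(2) by (rule real_le_rsqrt)
    then show ?thesis
      using that assms by (auto simp: potential_def intro!: divide_left_mono)
  qed
  show "potential d \<le> 1 / 4"
    using pot[of 2] assms by simp
  \<comment> \<open>The coefficients are \<open>3 / 4 - k\<close> and \<open>2 * k - 1\<close> for
    \<open>k = 0.5774\<close>. As \<open>real d - 2\<close> is nonnegative, an upper bound for
    \<open>1 / sqrt 3\<close> is what is wanted.\<close>
  have "1726 / 10000 * real d + 1548 / 10000 = 3 / 4 * real d - 1 - (real d - 2) * (5774 / 10000)"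
    by (simp add: field_simps)
  also have "\<dots> \<le> 3 / 4 * real d - 1 - (real d - 2) * (1 / sqrt 3)"
    using assms k by (intro diff_left_mono mult_left_mono) auto
  also have "\<dots> = 2 / sqrt 3 - 1 + (3 / 4 - 1 / sqrt 3) * real d"
    by (simp add: algebra_simps diff_divide_distrib)
  finally have "1726 / 10000 * real d + 1548 / 10000 \<le> 2 / sqrt 3 - 1 + (3 / 4 - 1 / sqrt 3) * real d" .
  moreover have "(real d - 1) * potential d + 1 / 4 < 1726 / 10000 * real d + 1548 / 10000"
  proof -
    \<comment> \<open>The numbers 2.449, 2.8 and 3.125 lie below the square roots of 6, 8 and 10.
      From \<open>d = 5\<close> on, the slope \<open>0.16 = 1 / (2 * 3.125)\<close> is below 0.1726,
      so a linear comparison suffices.\<close>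
    consider "d = 3" | "d = 4" | "5 \<le> d"
      using assms by linarith
    then show ?thesis
    proof cases
      case 1
      then have "potential d \<le> 1 / (2 * 2.449)"
        by (intro pot) (auto simp: power2_eq_square)
      with 1 show ?thesis by simp
    next
      case 2
      then have "potential d \<le> 1 / (2 * 2.8)"
        by (intro pot) (auto simp: power2_eq_square)
      with 2 show ?thesis by simp
    next
      case 3
      then have "potential d \<le> 1 / (2 * 3.125)"
        by (intro pot) (auto simp: power2_eq_square)
      then have "(real d - 1) * potential d + 1 / 4 \<le> (real d - 1) * 0.16 + 1 / 4"
        using 3 by (intro add_right_mono mult_left_mono) auto
      also have "\<dots> < 1726 / 10000 * real d + 1548 / 10000"
        using 3 by (simp add: field_simps)
      finally show ?thesis .
    qed
  qed
  ultimately show "(real d - 1) * potential d + 1 / 4 < 2 / sqrt 3 - 1 + (3 / 4 - 1 / sqrt 3) * real d"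
    by linarith
qed

section \<open>The handshake lemma and small degrees\<close>

lemma degree_sum:
  assumes "simple_graph G"
  shows "(\<Sum>v\<in>verts G. degree G v) = 2 * card (edges G)"
proof -
  note fin = simple_graph_finite[OF assms]
  have "(\<Sum>v\<in>verts G. degree G v) = (\<Sum>v\<in>verts G. \<Sum>e\<in>{e \<in> edges G. v \<in> e}. 1)"
    by (simp add: degree_def)
  also have "\<dots> = (\<Sum>e\<in>edges G. \<Sum>v\<in>{v \<in> verts G. v \<in> e}. 1)"
    using fin by (intro sum.swap_restrict) auto
  also have "\<dots> = (\<Sum>e\<in>edges G. 2)"
  proof (intro sum.cong refl)
    fix e assume "e \<in> edges G"
    then have "{v \<in> verts G. v \<in> e} = e" "card e = 2"
      using assms unfolding simple_graph_def by auto
    then show "(\<Sum>v\<in>{v \<in> verts G. v \<in> e}. 1) = (2 :: nat)" by simp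
  qed
  finally show ?thesis by simp
qed

lemma degree_pos:
  assumes "simple_graph G" "graph_connected G" "2 \<le> card (verts G)" "v \<in> verts G"
  shows "1 \<le> degree G v"
proof -
  have "{v} \<noteq> verts G" using assms(3) by (auto dest: arg_cong[of _ _ card])
  then obtain b where "{v, b} \<in> edges G"
    using crossing_edge[OF assms(1,2), of "{v}"] assms(4) by blast
  then have "{e \<in> edges G. v \<in> e} \<noteq> {}" by blast
  then show ?thesis
    using simple_graph_finite[OF assms(1)] by (simp add: degree_def Suc_le_eq card_gt_0_iff)
qed

text \<open>Otherwise the edge would form a component with two vertices. This excludes the degree
  pair \<open>(1, 1)\<close>, at which the potential inequality fails.\<close>

lemma edge_not_isolated:
  assumes "simple_graph G" "graph_connected G" "3 \<le> card (verts G)" "{u, v} \<in> edges G"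
  shows "degree G u \<noteq> 1 \<or> degree G v \<noteq> 1"
proof -
  have fin: "finite (edges G)"
    using simple_graph_finite[OF assms(1)] by blast
  have sub: "{u, v} \<subseteq> verts G"
    using assms(1,4) unfolding simple_graph_def by blast
  have "card {u, v} \<le> 2" by (simp add: card_insert_if)
  then have "{u, v} \<noteq> verts G" using assms(3) by auto
  then obtain a b where ab: "a \<in> {u, v}" "b \<notin> {u, v}" "{a, b} \<in> edges G"
    using crossing_edge[OF assms(1,2) sub] by blast
  then have "{a, b} \<noteq> {u, v}" by auto
  then have "card {{a, b}, {u, v}} \<le> degree G a"
    unfolding degree_def using fin ab assms(4) by (intro card_mono) auto
  then have "degree G a \<noteq> 1"
    using \<open>{a, b} \<noteq> {u, v}\<close> by auto
  then show ?thesis using ab(1) by auto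
qed

text \<open>The loss when a path of length two at a vertex of degree \<open>d\<close> is shortened
  to a pendant vertex and the freed vertex lengthens the cycle: weights \<open>1 / sqrt 3\<close>
  and \<open>1 / sqrt (d + 2)\<close> give way to \<open>1 / 2\<close> and
  \<open>1 / sqrt (d + 1)\<close>.\<close>

definition pendant_slack :: "nat \<Rightarrow> real" where
  "pendant_slack d = 1 / sqrt 3 - 1 / 2 - (1 / sqrt (real d + 1) - 1 / sqrt (real d + 2))"

text \<open>Value of a cycle with \<open>d - 2\<close> long paths at one vertex: the
  \<open>d - 2\<close> final path edges weigh \<open>1 / sqrt 3\<close>, the \<open>d\<close> edges
  at the root \<open>1 / sqrt (d + 2)\<close>, and all remaining ones \<open>1 / 2\<close>.\<close>

definition long_paths_bound :: "nat \<Rightarrow> nat \<Rightarrow> real" where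
  "long_paths_bound n d = (real d - 2) / sqrt 3 + real d / sqrt (real d + 2)
     + 1 / 2 * (real n - 2 * real d + 2)"

text \<open>Since \<open>1 / 2 = 1 / sqrt 4\<close>, the slack compares the same difference at 3 and
  at \<open>d + 1\<close>; at \<open>d = 2\<close> it vanishes.\<close>

lemma pendant_slack_pos: "3 \<le> d \<Longrightarrow> 0 < pendant_slack d"
  using inverse_sqrt_diff_strict_antimono[of 3 "real d + 1"]
  by (simp add: pendant_slack_def add.commute)

lemma edge_weight_doubleton:
  "a \<noteq> b \<Longrightarrow> real (\<Sum>v\<in>{a, b}. degree G v) powr (-1/2)
    = 1 / sqrt (real (degree G a) + real (degree G b))"
  using powr_half_sqrt[of "real (degree G a) + real (degree G b)"]
    powr_minus_divide[of "real (degree G a) + real (degree G b)" "1 / 2"]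
  by simp

text \<open>The shares are summed by vertices instead of by edges and compared with
  \<open>h\<close>. The second part detects a further branching vertex by strict inequality, and the
  third evaluates every graph without one; the cycle enters only through the number of
  edges.\<close>

lemma sum_connectivity_bound:
  fixes G :: "'a graph" and x :: 'a
  assumes simple: "simple_graph G" and conn: "graph_connected G"
    and cardE: "card (edges G) = card (verts G)" and n3: "3 \<le> card (verts G)" and x: "x \<in> verts G"
  defines "b \<equiv> long_paths_bound (card (verts G)) (degree G x) - pendant_slack (degree G x)
      * real (card {v \<in> verts G. {v, x} \<in> edges G \<and> degree G v = 1})"
  shows "sum_connectivity G \<le> b"
    and "v \<in> verts G \<Longrightarrow> v \<noteq> x \<Longrightarrow> 3 \<le> degree G v \<Longrightarrow> sum_connectivity G < b"
    and "(\<And>v. v \<in> verts G \<Longrightarrow> v \<noteq> x \<Longrightarrow> degree G v \<le> 2) \<Longrightarrow> sum_connectivity G = b"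
proof -
  let ?V = "verts G" and ?E = "edges G" and ?d = "degree G"
  define D where "D = ?d x"
  define s where "s = pendant_slack D"
  define P where "P v \<longleftrightarrow> {v, x} \<in> ?E \<and> ?d v = 1" for v
  \<comment> \<open>The line through the share \<open>potential 1\<close> at degree 1 and the share
    \<open>2 * potential 2 = 1 / 2\<close> at degree 2.\<close>
  define \<alpha> \<beta> :: real where "\<alpha> = 2 / sqrt 3 - 1" and "\<beta> = 3 / 4 - 1 / sqrt 3"
  \<comment> \<open>The share of \<open>v\<close> in the edge \<open>e\<close>. On each of its edges
    \<open>x\<close> takes a fixed amount, chosen so that a neighbour of degree 2 is left with
    \<open>1 / 4 = potential 2\<close>; the neighbour takes the remainder.\<close>
  define g where "g v e = (if v = x then 1 / sqrt (real D + 2) - 1 / 4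
    else if x \<in> e then 1 / sqrt (real D + real (?d v)) - 1 / sqrt (real D + 2) + 1 / 4
    else potential (?d v))" for v e
  define S where "S v = (\<Sum>e\<in>{e \<in> ?E. v \<in> e}. g v e)" for v
  define w where "w e = real (\<Sum>v\<in>e. ?d v) powr (-1/2)" for e
  define h where "h v = \<alpha> + \<beta> * real (?d v) - s * of_bool (P v)" for v
  have fin: "finite ?V" "finite ?E"
    using simple_graph_finite[OF simple] by auto
  have pos: "1 \<le> ?d v" if "v \<in> ?V" for v
    using degree_pos[OF simple conn _ that] n3 by simp
  have at_x: "w e = (\<Sum>v\<in>e. g v e)" if e: "e \<in> ?E" "x \<in> e" for e
  proof -
    obtain a c where "e = {a, c}" "a \<noteq> c"
      using simple_graph_edgeE[OF simple e(1)] by metis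
    with e(2) obtain c where "e = {x, c}" "c \<noteq> x"
      by auto
    then show ?thesis
      using edge_weight_doubleton[of x c G] by (simp add: w_def g_def D_def)
  qed
  have off_x: "w e \<le> (\<Sum>v\<in>e. g v e)"
    "(\<And>v. v \<in> ?V \<Longrightarrow> v \<noteq> x \<Longrightarrow> ?d v \<le> 2) \<Longrightarrow> w e = (\<Sum>v\<in>e. g v e)"
    if e: "e \<in> ?E" "x \<notin> e" for e
  proof -
    obtain a c where ac: "e = {a, c}" "a \<noteq> c" "a \<in> ?V" "c \<in> ?V"
      using simple_graph_edgeE[OF simple e(1)] by metis
    have pre: "1 \<le> ?d a" "1 \<le> ?d c" "?d a \<noteq> 1 \<or> ?d c \<noteq> 1"
      using ac pos edge_not_isolated[OF simple conn n3] e(1) by auto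
    have "(\<Sum>v\<in>e. g v e) = potential (?d a) + potential (?d c)"
      using ac e(2) by (auto simp: g_def)
    moreover have "w e = 1 / sqrt (real (?d a) + real (?d c))"
      using edge_weight_doubleton[of a c G] ac by (simp add: w_def)
    ultimately show "w e \<le> (\<Sum>v\<in>e. g v e)"
      "(\<And>v. v \<in> ?V \<Longrightarrow> v \<noteq> x \<Longrightarrow> ?d v \<le> 2) \<Longrightarrow> w e = (\<Sum>v\<in>e. g v e)"
      using edge_weight_le_potential[OF pre] edge_weight_eq_potential[OF pre] ac e(2) by auto
  qed
  have swap: "(\<Sum>e\<in>?E. \<Sum>v\<in>e. g v e) = (\<Sum>v\<in>?V. S v)"
  proof -
    have "(\<Sum>v\<in>?V. S v) = (\<Sum>e\<in>?E. \<Sum>v\<in>{v \<in> ?V. v \<in> e}. g v e)"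
      unfolding S_def using fin by (intro sum.swap_restrict)
    also have "\<dots> = (\<Sum>e\<in>?E. \<Sum>v\<in>e. g v e)"
    proof (intro sum.cong refl)
      fix e v assume "e \<in> ?E"
      then show "{v \<in> ?V. v \<in> e} = e"
        using simple unfolding simple_graph_def by auto
    qed
    finally show ?thesis by simp
  qed
  have Sx: "S x = real D * (1 / sqrt (real D + 2) - 1 / 4)"
    by (simp add: S_def g_def D_def degree_def)
  have Sv: "S v = (real (?d v) - 1) * potential (?d v)
      + (1 / sqrt (real D + real (?d v)) - 1 / sqrt (real D + 2) + 1 / 4)"
    if "v \<noteq> x" "{v, x} \<in> ?E" for v
  proof -
    have "g v e = potential (?d v)" if e: "e \<in> {e \<in> ?E. v \<in> e} - {{v, x}}" for e
    proof -
      have "card e = 2" "v \<in> e" "e \<noteq> {v, x}"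
        using e simple unfolding simple_graph_def by auto
      then have "x \<notin> e"
        using \<open>v \<noteq> x\<close> by (auto simp: card_2_iff)
      then show ?thesis
        using \<open>v \<noteq> x\<close> by (simp add: g_def)
    qed
    then have "(\<Sum>e\<in>{e \<in> ?E. v \<in> e} - {{v, x}}. g v e)
      = real (card ({e \<in> ?E. v \<in> e} - {{v, x}})) * potential (?d v)"
      by simp
    also have "card ({e \<in> ?E. v \<in> e} - {{v, x}}) = ?d v - 1"
      using that(2) fin by (simp add: degree_def)
    finally have "(\<Sum>e\<in>{e \<in> ?E. v \<in> e} - {{v, x}}. g v e) = real (?d v - 1) * potential (?d v)" .
    moreover have "S v = g v {v, x} + (\<Sum>e\<in>{e \<in> ?E. v \<in> e} - {{v, x}}. g v e)"
      unfolding S_def using that(2) fin by (intro sum.remove) auto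
    moreover have "v \<in> ?V"
      using that(2) simple unfolding simple_graph_def by auto
    ultimately show ?thesis
      using that(1) pos[of v] by (simp add: g_def of_nat_diff)
  qed
  have Sv': "S v = real (?d v) * potential (?d v)" if "v \<noteq> x" "{v, x} \<notin> ?E" for v
  proof -
    have "g v e = potential (?d v)" if e: "e \<in> {e \<in> ?E. v \<in> e}" for e
    proof -
      have "card e = 2" "v \<in> e" "e \<noteq> {v, x}"
        using e \<open>{v, x} \<notin> ?E\<close> simple unfolding simple_graph_def by auto
      then have "x \<notin> e"
        using \<open>v \<noteq> x\<close> by (auto simp: card_2_iff)
      then show ?thesis
        using \<open>v \<noteq> x\<close> by (simp add: g_def)
    qed
    then show ?thesis
      by (simp add: S_def degree_def)
  qed
  \<comment> \<open>Degrees 1 and 2 are the interpolation points of the line, and a pendant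
    neighbour of \<open>x\<close> falls short of it by exactly \<open>s\<close>.\<close>
  have small: "S v = h v" if "v \<in> ?V" "v \<noteq> x" "?d v \<le> 2" for v
  proof -
    have "?d v = 1 \<or> ?d v = 2"
      using pos[OF that(1)] that(3) by linarith
    then show ?thesis
      using Sv[of v] Sv'[of v] that(2)
      by (cases "{v, x} \<in> ?E")
        (auto simp: h_def P_def \<alpha>_def \<beta>_def s_def pendant_slack_def potential_def algebra_simps)
  qed
  \<comment> \<open>The edge to \<open>x\<close> weighs no more than for a neighbour of degree 2, so
    the bracket in \<open>Sv\<close> is at most \<open>1 / 4\<close>.\<close>
  have large: "S v < h v" if "v \<in> ?V" "v \<noteq> x" "3 \<le> ?d v" for v
  proof -
    have h: "h v = \<alpha> + \<beta> * real (?d v)"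
      using that(3) by (simp add: h_def P_def)
    have "1 / sqrt (real D + real (?d v)) \<le> 1 / sqrt (real D + 2)"
      using that(3) by (intro divide_left_mono) auto
    then show ?thesis
      using potential_branch_less[OF that(3)] Sv[of v] Sv'[of v] that(2)
      by (cases "{v, x} \<in> ?E") (auto simp: h \<alpha>_def \<beta>_def algebra_simps)
  qed
  have le: "S v \<le> h v" if "v \<in> ?V" "v \<noteq> x" for v
    using small[OF that] large[OF that] by (cases "?d v \<le> 2") auto
  \<comment> \<open>With as many edges as vertices, the degrees sum to twice the number of vertices;
    hence the sum of \<open>h\<close> depends only on that number, on \<open>D\<close> and on the
    number of pendant neighbours.\<close>
  have total: "S x + (\<Sum>v\<in>?V - {x}. h v) = b"
  proof -
    have "\<not> P x"
      using simple by (auto simp: P_def simple_graph_def)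
    then have "{v \<in> ?V - {x}. P v} = {v \<in> ?V. P v}" by auto
    then have "(\<Sum>v\<in>?V - {x}. of_bool (P v)) = real (card {v \<in> ?V. P v})"
      using fin by (simp add: sum_of_bool_eq Int_def conj_commute)
    moreover have "(\<Sum>v\<in>?V. real (?d v)) = 2 * real (card ?V)"
      using degree_sum[OF simple] cardE by (simp flip: of_nat_sum)
    then have "(\<Sum>v\<in>?V - {x}. real (?d v)) = 2 * real (card ?V) - real D"
      using fin x by (simp add: sum_diff1 D_def)
    ultimately have "(\<Sum>v\<in>?V - {x}. h v) = \<alpha> * (real (card ?V) - 1)
      + \<beta> * (2 * real (card ?V) - real D) - s * real (card {v \<in> ?V. P v})"
      using n3 fin x unfolding h_def
      by (simp add: sum.distrib sum_subtractf of_nat_diff mult.commute flip: sum_distrib_left)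
    then show ?thesis
      unfolding b_def Sx s_def D_def P_def \<alpha>_def \<beta>_def long_paths_bound_def
      by (simp add: algebra_simps diff_divide_distrib add_divide_distrib)
  qed
  have "sum_connectivity G = (\<Sum>e\<in>?E. w e)"
    by (simp add: sum_connectivity_def w_def)
  moreover have "w e \<le> (\<Sum>v\<in>e. g v e)" if "e \<in> ?E" for e
    using at_x[OF that] off_x(1)[OF that] by (cases "x \<in> e") auto
  ultimately have "sum_connectivity G \<le> (\<Sum>v\<in>?V. S v)"
    unfolding swap[symmetric] by (simp add: sum_mono)
  moreover have Ssum: "(\<Sum>v\<in>?V. S v) = S x + (\<Sum>v\<in>?V - {x}. S v)"
    using fin x by (intro sum.remove) auto
  ultimately have upper: "sum_connectivity G \<le> S x + (\<Sum>v\<in>?V - {x}. S v)"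
    by simp
  show "sum_connectivity G \<le> b"
    using upper sum_mono[of "?V - {x}" S h] le total by force
  show "sum_connectivity G < b" if "v \<in> ?V" "v \<noteq> x" "3 \<le> ?d v"
  proof -
    have "(\<Sum>v\<in>?V - {x}. S v) < (\<Sum>v\<in>?V - {x}. h v)"
      using fin le large that by (intro sum_strict_mono_ex1) auto
    then show ?thesis
      using upper total by linarith
  qed
  show "sum_connectivity G = b" if all: "\<And>v. v \<in> ?V \<Longrightarrow> v \<noteq> x \<Longrightarrow> ?d v \<le> 2"
  proof -
    have "w e = (\<Sum>v\<in>e. g v e)" if "e \<in> ?E" for e
      using at_x[OF that] off_x(2)[OF that _ all] by (cases "x \<in> e") auto
    then have "sum_connectivity G = S x + (\<Sum>v\<in>?V - {x}. S v)"
      unfolding Ssum[symmetric] swap[symmetric] by (simp add: sum_connectivity_def w_def)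
    also have "(\<Sum>v\<in>?V - {x}. S v) = (\<Sum>v\<in>?V - {x}. h v)"
      using small all by (intro sum.cong) auto
    finally show ?thesis
      using total by simp
  qed
qed

section \<open>The extremal graphs\<close>

lemma card_neighbours:
  assumes "simple_graph G"
  shows "card {v \<in> verts G. {v, x} \<in> edges G} = degree G x"
  unfolding degree_def
proof (rule bij_betw_same_card)
  show "bij_betw (\<lambda>v. {v, x}) {v \<in> verts G. {v, x} \<in> edges G} {e \<in> edges G. x \<in> e}"
  proof (rule bij_betw_imageI)
    show "inj_on (\<lambda>v. {v, x}) {v \<in> verts G. {v, x} \<in> edges G}"
      by (auto simp: inj_on_def doubleton_eq_iff)
    show "(\<lambda>v. {v, x}) ` {v \<in> verts G. {v, x} \<in> edges G} = {e \<in> edges G. x \<in> e}"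
    proof (intro equalityI subsetI)
      fix e assume e: "e \<in> {e \<in> edges G. x \<in> e}"
      then obtain a b where ab: "e = {a, b}" "a \<in> verts G" "b \<in> verts G"
        using simple_graph_edgeE[OF assms, of e] by blast
      then have "e = {b, x} \<or> e = {a, x}"
        using e by auto
      then show "e \<in> (\<lambda>v. {v, x}) ` {v \<in> verts G. {v, x} \<in> edges G}"
        using e ab by blast
    qed auto
  qed
qed

text \<open>There are at least \<open>d\<^sub>x - 2\<close> pendant vertices, and all but \<open>n - 1 - d\<^sub>x\<close> of them are adjacent
  to \<open>x\<close>.\<close>

lemma card_pendant_neighbours_ge:
  assumes simple: "simple_graph G" and conn: "graph_connected G"
    and cardE: "card (edges G) = card (verts G)" and n2: "2 \<le> card (verts G)" and x: "x \<in> verts G"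
  shows "2 * degree G x \<le> card (verts G) + 1 + card {v \<in> verts G. {v, x} \<in> edges G \<and> degree G v = 1}"
proof -
  let ?V = "verts G"
  define N Q P where "N = {v \<in> ?V. {v, x} \<in> edges G}" and "Q = {v \<in> ?V - {x}. degree G v = 1}"
    and "P = {v \<in> ?V. {v, x} \<in> edges G \<and> degree G v = 1}"
  have fin: "finite ?V"
    using simple_graph_finite[OF simple] by blast
  have "x \<notin> N"
    using simple by (auto simp: N_def simple_graph_def)
  have "(\<Sum>v\<in>?V. int (degree G v)) = 2 * int (card ?V)"
    using degree_sum[OF simple] cardE by (simp flip: of_nat_sum)
  then have "(\<Sum>v\<in>?V - {x}. int (degree G v)) = 2 * int (card ?V) - int (degree G x)"
    using fin x by (simp add: sum_diff1)
  \<comment> \<open>The values \<open>2 - degree G v\<close> sum to 0 over all vertices, so those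
    other than \<open>x\<close> contribute \<open>degree G x - 2\<close>. Only pendant vertices
    contribute positively, each 1.\<close>
  then have "int (degree G x) - 2 = (\<Sum>v\<in>?V - {x}. 2 - int (degree G v))"
    using fin x n2 by (simp add: sum_subtractf of_nat_diff)
  also have "\<dots> \<le> (\<Sum>v\<in>?V - {x}. of_bool (degree G v = 1))"
  proof (rule sum_mono)
    fix v assume "v \<in> ?V - {x}"
    then have "1 \<le> degree G v"
      using degree_pos[OF simple conn n2] by blast
    then show "2 - int (degree G v) \<le> of_bool (degree G v = 1)"
      by (auto simp: of_bool_def)
  qed
  also have "\<dots> = int (card Q)"
    using fin by (simp add: Q_def sum_of_bool_eq Int_def conj_commute)
  finally have "int (degree G x) - 2 \<le> int (card Q)" .
  moreover have "card Q \<le> card (P \<union> (?V - {x} - N))"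
    using fin by (intro card_mono) (auto simp: P_def Q_def N_def)
  moreover have "card (P \<union> (?V - {x} - N)) \<le> card P + card (?V - {x} - N)"
    by (rule card_Un_le)
  moreover have "card (insert x N) + card (?V - {x} - N) = card ?V"
  proof -
    have "insert x N \<subseteq> ?V" using x by (auto simp: N_def)
    moreover have "?V - {x} - N = ?V - insert x N" by auto
    moreover have "finite (insert x N)"
      using fin by (simp add: N_def)
    ultimately show ?thesis
      using fin card_mono[of ?V "insert x N"] card_Diff_subset[of "insert x N" ?V] by simp
  qed
  moreover have "card (insert x N) = Suc (degree G x)"
    using \<open>x \<notin> N\<close> fin card_neighbours[OF simple, of x] by (simp add: N_def)
  ultimately show ?thesis
    unfolding P_def by linarith
qed

section \<open>Relabelling cycles with attached paths\<close>

lemma distinct_lists_bij: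
  assumes "distinct xs" "distinct ys" "length xs = length ys"
  obtains f where "bij_betw f (set xs) (set ys)" "map f xs = ys"
proof -
  define f where "f = the \<circ> map_of (zip xs ys)"
  have "map f xs = ys"
    using assms by (intro nth_equalityI) (auto simp: f_def map_of_zip_nth)
  moreover from this have "bij_betw f (set xs) (set ys)"
    using assms(2) unfolding bij_betw_def by (metis distinct_map set_map)
  ultimately show ?thesis using that by blast
qed

lemma concat_eq_map_length_eq: "concat ps = concat qs \<Longrightarrow> map length ps = map length qs \<Longrightarrow> ps = qs"
proof (induction ps arbitrary: qs)
  case (Cons p ps)
  then show ?case by (cases qs) auto
qed simp

lemma cycle_with_paths_listI:
  assumes "distinct (xs @ concat ps)" "3 \<le> length xs" "\<And>p. p \<in> set ps \<Longrightarrow> p \<noteq> []"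
  shows "cycle_with_paths (cycle_graph xs) (hd xs) ps"
proof
  show "is_cycle (cycle_graph xs)"
    using assms unfolding is_cycle_def by auto
  show "hd xs \<in> verts (cycle_graph xs)"
    using assms(2) by (cases xs) (auto simp: cycle_graph_def)
qed (use assms in \<open>auto simp: cycle_graph_def\<close>)

lemma attach_cycle_map:
  assumes "xs \<noteq> []"
  shows "attach_paths (hd (map f xs)) (cycle_graph (map f xs)) (map (map f) ps) =
    (f ` verts (attach_paths (hd xs) (cycle_graph xs) ps),
     (`) f ` edges (attach_paths (hd xs) (cycle_graph xs) ps))"
  using assms attach_paths_map[of f "hd xs" "cycle_graph xs" ps] by (simp add: cycle_graph_map hd_map)

lemma verts_attach_cycle: "verts (attach_paths u (cycle_graph xs) ps) = set (xs @ concat ps)"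
  by (simp add: attach_paths_eq cycle_graph_def)

text \<open>The vertices of both graphs are listed in the same order, the cycle first and then path
  after path. Matching positions gives a bijection, and equal lengths make it respect the cycle and
  the paths.\<close>

lemma graph_iso_attach_cycle:
  assumes "distinct (xs @ concat ps)" "distinct (ys @ concat qs)"
    and "length xs = length ys" "xs \<noteq> []" "map length ps = map length qs"
  shows "graph_iso (attach_paths (hd xs) (cycle_graph xs) ps) (attach_paths (hd ys) (cycle_graph ys) qs)"
proof -
  have "length (xs @ concat ps) = length (ys @ concat qs)"
    using assms(3,5) by (simp add: length_concat)
  then obtain f where f: "bij_betw f (set (xs @ concat ps)) (set (ys @ concat qs))"
    "map f (xs @ concat ps) = ys @ concat qs"
    using distinct_lists_bij[OF assms(1,2)] by blast
  then have ys: "map f xs = ys" and "concat (map (map f) ps) = concat qs"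
    using assms(3) by (auto simp: map_concat)
  moreover have "map length (map (map f) ps) = map length qs"
    using assms(5) by (simp add: comp_def)
  ultimately have "map (map f) ps = qs"
    using concat_eq_map_length_eq by blast
  then show ?thesis
    using f(1) attach_cycle_map[OF assms(4), of f ps] ys
    unfolding graph_iso_def verts_attach_cycle by (intro exI[of _ f]) simp
qed

lemma graph_iso_attach_cycleE:
  assumes "simple_graph G" "graph_iso G (attach_paths (hd ys) (cycle_graph ys) qs)"
    and "distinct (ys @ concat qs)" "ys \<noteq> []"
  obtains xs ps where "G = attach_paths (hd xs) (cycle_graph xs) ps" "distinct (xs @ concat ps)"
    "length xs = length ys" "map length ps = map length qs"
proof -
  define H where "H = attach_paths (hd ys) (cycle_graph ys) qs"
  obtain f where f: "bij_betw f (verts G) (verts H)" "edges H = (`) f ` edges G"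
    using assms(2) unfolding graph_iso_def H_def by blast
  define g where "g = inv_into (verts G) f"
  have g: "bij_betw g (verts H) (verts G)"
    unfolding g_def by (rule bij_betw_inv_into[OF f(1)])
  \<comment> \<open>Edges of a simple graph consist of vertices, and on these \<open>g\<close>
    inverts \<open>f\<close>.\<close>
  have "g ` f ` e = e" if "e \<in> edges G" for e
    using that assms(1) f(1) unfolding g_def simple_graph_def bij_betw_def
    by (metis inv_into_image_cancel)
  then have "(`) g ` edges H = edges G"
    unfolding f(2) by (simp add: image_image)
  then have "G = (g ` verts H, (`) g ` edges H)"
    using g by (simp add: bij_betw_def)
  also have "\<dots> = attach_paths (hd (map g ys)) (cycle_graph (map g ys)) (map (map g) qs)"
    unfolding H_def by (rule attach_cycle_map[OF assms(4), symmetric])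
  finally have eq: "G = \<dots>" .
  moreover have "distinct (map g (ys @ concat qs))"
    using g assms(3) unfolding distinct_map H_def verts_attach_cycle bij_betw_def by blast
  ultimately show ?thesis
    by (intro that[OF eq]) (auto simp: map_concat comp_def)
qed

section \<open>The numbering of \<open>U_graph\<close>\<close>

lemma concat_singletons: "concat (map (\<lambda>i. [a + i]) [0..<k]) = [a..<a + k]" for a :: nat
  by (induction k) auto

lemma concat_pairs: "concat (map (\<lambda>j. [a + 2 * j, Suc (a + 2 * j)]) [0..<k]) = [a..<a + 2 * k]" for a :: nat
  by (induction k) auto

lemma U_graph_eq:
  assumes "n + 2 \<le> 2 * \<Delta>" "\<Delta> \<le> n - 1"
  obtains qs where "U_graph n \<Delta> = attach_paths (hd [0, 1, 2]) (cycle_graph [0, 1, 2]) qs"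
    "distinct ([0, 1, 2] @ concat qs)"
    "map length qs = replicate (2 * \<Delta> - n - 1) 1 @ replicate (n - \<Delta> - 1) 2"
proof
  let ?qs = "map (\<lambda>i. [3 + i]) [0..<2 * \<Delta> - n - 1] @
    map (\<lambda>j. [2 * \<Delta> - n + 2 + 2 * j, 2 * \<Delta> - n + 3 + 2 * j]) [0..<n - \<Delta> - 1]"
  show "U_graph n \<Delta> = attach_paths (hd [0, 1, 2]) (cycle_graph [0, 1, 2]) ?qs"
    by (simp add: U_graph_def)
  have "(\<lambda>j. [2 * \<Delta> - n + 2 + 2 * j, 2 * \<Delta> - n + 3 + 2 * j]) =
      (\<lambda>j. [2 * \<Delta> - n + 2 + 2 * j, Suc (2 * \<Delta> - n + 2 + 2 * j)])"
    by (simp add: fun_eq_iff)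
  \<comment> \<open>The blocks of labels are consecutive: the pairs begin where the pendant vertices
    end, and the labels stop at \<open>n - 1\<close>.\<close>
  then have "concat ?qs = [3..<3 + (2 * \<Delta> - n - 1)] @
      [2 * \<Delta> - n + 2..<2 * \<Delta> - n + 2 + 2 * (n - \<Delta> - 1)]"
    by (simp only: concat_append concat_singletons concat_pairs)
  also have "3 + (2 * \<Delta> - n - 1) = 2 * \<Delta> - n + 2"
    using assms by simp
  also have "[3..<2 * \<Delta> - n + 2] @ [2 * \<Delta> - n + 2..<2 * \<Delta> - n + 2 + 2 * (n - \<Delta> - 1)]
      = [3..<2 * \<Delta> - n + 2 + 2 * (n - \<Delta> - 1)]"
    using assms by (intro upt_add_eq_append[symmetric]) simp
  also have "2 * \<Delta> - n + 2 + 2 * (n - \<Delta> - 1) = n"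
    using assms by simp
  finally have "concat ?qs = [3..<n]" .
  then show "distinct ([0, 1, 2] @ concat ?qs)"
    by (simp only:) simp
  show "map length ?qs = replicate (2 * \<Delta> - n - 1) 1 @ replicate (n - \<Delta> - 1) 2"
    by (simp add: comp_def map_replicate_const)
qed

section \<open>Values and recognition of the extremal graphs\<close>

lemma card_cycle_ge_3: "is_cycle C \<Longrightarrow> 3 \<le> card (verts C)"
  by (auto simp: is_cycle_def cycle_graph_def distinct_card)

lemma unicyclic_card_ge_3:
  assumes "unicyclic G"
  shows "3 \<le> card (verts G)"
proof -
  obtain C where C: "is_cycle C" "subgraph C G"
    using assms unfolding unicyclic_def by blast
  then have "card (verts C) \<le> card (verts G)"
    using assms simple_graph_finite[of G] unfolding unicyclic_def subgraph_def
    by (intro card_mono) auto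
  then show ?thesis
    using card_cycle_ge_3[OF C(1)] by simp
qed

text \<open>No vertex other than the root has degree above 2, so the estimate is exact at the root,
  whose pendant neighbours are the paths of length one.\<close>

lemma sum_connectivity_cycle_with_paths:
  assumes "unicyclic G" "cycle_with_paths C u ps" "G = attach_paths u C ps"
  shows "sum_connectivity G = long_paths_bound (card (verts G)) (2 + length ps)
    - pendant_slack (2 + length ps) * real (length (filter (\<lambda>p. length p = 1) ps))"
proof -
  interpret cycle_with_paths C u ps by fact
  have "u \<in> verts (attach_paths u C ps)"
    using root by (simp add: attach_paths_eq)
  moreover note G = assms(1)[unfolded assms(3)]
  moreover from G have "simple_graph (attach_paths u C ps)" "graph_connected (attach_paths u C ps)"
    unfolding unicyclic_def by auto
  ultimately show ?thesis
    using sum_connectivity_bound(3)[OF _ _ unicyclic_card_edges[OF G] unicyclic_card_ge_3[OF G], of u]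
      degree_le_2 degree_root card_pendant_neighbours
    by (simp add: assms(3))
qed

lemma length_concat_ge: "(\<And>p. p \<in> set ps \<Longrightarrow> k \<le> length p) \<Longrightarrow> k * length ps \<le> length (concat ps)"
  by (induction ps) (auto intro: add_mono)

lemma length_concat_minimal:
  assumes "\<And>p. p \<in> set ps \<Longrightarrow> k \<le> length p" "length (concat ps) \<le> k * length ps"
  shows "map length ps = replicate (length ps) k"
  using assms
proof (induction ps)
  case (Cons p ps)
  then have "k * length ps \<le> length (concat ps)" "k \<le> length p"
    by (auto intro: length_concat_ge)
  moreover have "length p + length (concat ps) \<le> k + k * length ps"
    using Cons.prems(2) by simp
  ultimately have "length p = k" "length (concat ps) \<le> k * length ps"
    by linarith+
  with Cons show ?case by simp
qed simp

text \<open>The other \<open>n - \<Delta> - 1\<close> paths have at least 2 vertices each and the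
  cycle has at least 3; together with the pendant vertices these minima already add up to
  \<open>n\<close>. So the cycle is a triangle and the other paths have length exactly two.\<close>

lemma graph_iso_U_graph:
  assumes cwp: "cycle_with_paths C u ps" and len: "length ps = \<Delta> - 2"
    and \<Delta>: "n + 2 \<le> 2 * \<Delta>" "\<Delta> \<le> n - 1" "card (verts (attach_paths u C ps)) = n"
    and ones: "length (filter (\<lambda>p. length p = 1) ps) = 2 * \<Delta> - n - 1"
  shows "graph_iso (attach_paths u C ps) (U_graph n \<Delta>)"
proof -
  interpret cycle_with_paths C u ps by fact
  define ps1 ps2 where "ps1 = filter (\<lambda>p. length p = 1) ps" and "ps2 = filter (\<lambda>p. length p \<noteq> 1) ps"
  have "length ps1 + length ps2 = length ps"
    unfolding ps1_def ps2_def by (rule sum_length_filter_compl)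
  then have l2: "length ps2 = n - \<Delta> - 1"
    using len ones \<Delta> by (simp add: ps1_def)
  have ge2: "2 \<le> length p" if "p \<in> set ps2" for p
  proof -
    have "p \<in> set ps" "length p \<noteq> 1"
      using that by (auto simp: ps2_def)
    moreover from this(1) have "length p \<noteq> 0"
      using nonempty by simp
    ultimately show ?thesis by linarith
  qed
  have perm: "set (ps1 @ ps2) = set ps"
    by (auto simp: ps1_def ps2_def)
  have m1: "map length ps1 = replicate (2 * \<Delta> - n - 1) 1"
  proof -
    have "replicate (length (map length ps1)) 1 = map length ps1"
      by (rule replicate_length_same) (auto simp: ps1_def)
    then show ?thesis
      using ones by (simp add: ps1_def)
  qed
  have "length (concat ps) = length (concat ps1) + length (concat ps2)"
    unfolding ps1_def ps2_def by (induction ps) auto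
  moreover have "length (concat ps1) = 2 * \<Delta> - n - 1"
    using m1 by (simp add: length_concat sum_list_replicate)
  ultimately have n: "n = card (verts C) + (2 * \<Delta> - n - 1) + length (concat ps2)"
    using card_verts \<Delta>(3) by simp
  have "2 * length ps2 \<le> length (concat ps2)"
    using ge2 by (rule length_concat_ge)
  then have C3: "card (verts C) = 3" and "length (concat ps2) \<le> 2 * length ps2"
    using n l2 card_cycle_ge_3[OF cycle] \<Delta> by linarith+
  then have m2: "map length ps2 = replicate (n - \<Delta> - 1) 2"
    using length_concat_minimal[OF ge2] l2 by metis
  obtain ys where ys: "distinct (u # ys)" "C = cycle_graph (u # ys)"
    using is_cycle_from[OF cycle root] by blast
  then have "length (u # ys) = 3"
    using C3 distinct_card[of "u # ys"] by (simp add: cycle_graph_def)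
  moreover have "length (concat (ps1 @ ps2)) = length (concat ps)"
    using \<open>length (concat ps) = _\<close> by simp
  moreover have "set (concat (ps1 @ ps2)) = set (concat ps)"
    unfolding set_concat perm ..
  ultimately have "distinct (concat (ps1 @ ps2))"
    using distinct by (metis card_distinct distinct_card)
  then have d: "distinct ((u # ys) @ concat (ps1 @ ps2))"
    using ys disjoint \<open>set (concat (ps1 @ ps2)) = _\<close> by (auto simp: cycle_graph_def)
  \<comment> \<open>Listing the paths of length one first does not change the graph and matches the
    order in \<open>U_graph\<close>.\<close>
  have "attach_paths u C ps = attach_paths (hd (u # ys)) (cycle_graph (u # ys)) (ps1 @ ps2)"
    using perm ys(2) by (auto simp: attach_paths_eq)
  moreover obtain qs where "U_graph n \<Delta> = attach_paths (hd [0, 1, 2]) (cycle_graph [0, 1, 2]) qs"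
    "distinct ([0, 1, 2] @ concat qs)"
    "map length qs = replicate (2 * \<Delta> - n - 1) 1 @ replicate (n - \<Delta> - 1) 2"
    using U_graph_eq[OF \<Delta>(1,2)] by blast
  ultimately show ?thesis
    using graph_iso_attach_cycle[OF d, of "[0, 1, 2]" qs] m1 m2 \<open>length (u # ys) = 3\<close> by simp
qed

text \<open>Pulls the shape of \<open>U_graph\<close> back to \<open>G\<close>; the number of paths
  is \<open>(2 * \<Delta> - n - 1) + (n - \<Delta> - 1) = \<Delta> - 2\<close>.\<close>

lemma U_graph_isoE:
  assumes "simple_graph G" "graph_iso G (U_graph n \<Delta>)" "n + 2 \<le> 2 * \<Delta>" "\<Delta> \<le> n - 1"
  obtains C u ps where "cycle_with_paths C u ps" "G = attach_paths u C ps" "length ps = \<Delta> - 2"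
    "length (filter (\<lambda>p. length p = 1) ps) = 2 * \<Delta> - n - 1"
proof -
  obtain qs where qs: "U_graph n \<Delta> = attach_paths (hd [0, 1, 2]) (cycle_graph [0, 1, 2]) qs"
    "distinct ([0, 1, 2] @ concat qs)"
    "map length qs = replicate (2 * \<Delta> - n - 1) 1 @ replicate (n - \<Delta> - 1) 2"
    using U_graph_eq[OF assms(3,4)] by blast
  obtain xs ps where xs: "G = attach_paths (hd xs) (cycle_graph xs) ps" "distinct (xs @ concat ps)"
    "length xs = length [0, 1, 2 :: nat]" "map length ps = map length qs"
    using graph_iso_attach_cycleE[OF assms(1) assms(2)[unfolded qs(1)] qs(2)] by blast
  have lens: "map length ps = replicate (2 * \<Delta> - n - 1) 1 @ replicate (n - \<Delta> - 1) 2"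
    using xs(4) qs(3) by simp
  have "length ps = \<Delta> - 2"
    using arg_cong[OF lens, of length] assms(3,4) by simp
  moreover have "length (filter (\<lambda>p. length p = 1) ps) = length (filter (\<lambda>k. k = 1) (map length ps))"
    by (simp add: filter_map comp_def)
  then have "length (filter (\<lambda>p. length p = 1) ps) = 2 * \<Delta> - n - 1"
    by (simp add: lens)
  moreover have "p \<noteq> []" if "p \<in> set ps" for p
  proof
    assume "p = []"
    with that have "0 \<in> set (map length ps)" by force
    then show False by (simp add: lens)
  qed
  then have "cycle_with_paths (cycle_graph xs) (hd xs) ps"
    using xs by (intro cycle_with_paths_listI) auto
  ultimately show ?thesis
    using that xs(1) by blast
qed

section \<open>The two bounds and their equality cases\<close>

theorem theorem2:
  fixes G :: "'a graph" and n \<Delta> :: nat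
  assumes "2 \<le> \<Delta>" and "\<Delta> \<le> n - 1"
    and "unicyclic G"
    and "card (verts G) = n"
    and "max_degree G = \<Delta>"
  shows "((real n + 2) / 2 \<le> real \<Delta> \<longrightarrow>
            (let b = (real n - real \<Delta> - 1) / sqrt 3
                   + (real n - real \<Delta> + 1) / sqrt (real \<Delta> + 2)
                   + (2 * real \<Delta> - real n - 1) / sqrt (real \<Delta> + 1) + 1 / 2
             in sum_connectivity G \<le> b \<and>
                (sum_connectivity G = b \<longleftrightarrow> graph_iso G (U_graph n \<Delta>)))) \<and>
         (real \<Delta> \<le> (real n + 1) / 2 \<longrightarrow>
            (let b = (real \<Delta> - 2) / sqrt 3
                   + real \<Delta> / sqrt (real \<Delta> + 2)
                   + 1 / 2 * (real n - 2 * real \<Delta> + 2)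
             in sum_connectivity G \<le> b \<and>
                (sum_connectivity G = b \<longleftrightarrow> cycle_with_long_paths (\<Delta> - 2) G)))"
proof -
  let ?\<chi> = "sum_connectivity G"
  have simple: "simple_graph G" and conn: "graph_connected G"
    using assms(3) unfolding unicyclic_def by auto
  have fin: "finite (verts G)"
    using simple_graph_finite[OF simple] by blast
  have n3: "3 \<le> card (verts G)"
    using unicyclic_card_ge_3[OF assms(3)] .
  have max: "degree G v \<le> \<Delta>" if "v \<in> verts G" for v
    using that fin assms(5) by (auto simp: max_degree_def)
  have "Max (degree G ` verts G) \<in> degree G ` verts G"
    using fin n3 by (intro Max_in) auto
  then obtain y where y: "y \<in> verts G" "degree G y = \<Delta>"
    using assms(5) by (auto simp: max_degree_def)
  define L where "L x = card {v \<in> verts G. {v, x} \<in> edges G \<and> degree G v = 1}" for x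
  note bound = sum_connectivity_bound[OF simple conn unicyclic_card_edges[OF assms(3)] n3 y(1),
      unfolded assms(4) y(2), folded L_def]
  have shape: "\<exists>C ps. cycle_with_paths C y ps \<and> G = attach_paths y C ps \<and> length ps = \<Delta> - 2 \<and>
      length (filter (\<lambda>p. length p = 1) ps) = L y"
    if eq: "\<Delta> = 2 \<or> long_paths_bound n \<Delta> - pendant_slack \<Delta> * real (L y) \<le> ?\<chi>"
  proof -
    \<comment> \<open>Either no degree exceeds 2 at all, or a further vertex of degree at least 3
      would push the index strictly below the bound.\<close>
    have le2: "degree G v \<le> 2" if "v \<in> verts G" "v \<noteq> y" for v
      using bound(2)[OF that] eq max[OF that(1)] by (cases "degree G v \<le> 2") auto
    obtain C ps where "cycle_with_paths C y ps" "G = attach_paths y C ps"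
      by (rule unicyclic_eq_cycle_with_paths[OF assms(3) y(1) le2])
    then show ?thesis
      using cycle_with_paths.degree_root[of C y ps] y(2)
        cycle_with_paths.card_pendant_neighbours[of C y ps]
      by (intro exI[of _ C] exI[of _ ps]) (auto simp: L_def)
  qed
  have two: "Suc (Suc (\<Delta> - 2)) = \<Delta>"
    using assms(1) by simp
  note exact = sum_connectivity_cycle_with_paths[OF assms(3), unfolded assms(4)]
  show ?thesis
  proof (intro conjI impI)
    assume "(real n + 2) / 2 \<le> real \<Delta>"
    then have "real (n + 2) \<le> real (2 * \<Delta>)"
      by simp
    then have \<Delta>: "n + 2 \<le> 2 * \<Delta>"
      by (simp only: of_nat_le_iff)
    then have "3 \<le> \<Delta>" using n3 assms(4) by linarith
    define b where "b = (real n - real \<Delta> - 1) / sqrt 3 + (real n - real \<Delta> + 1) / sqrt (real \<Delta> + 2)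
      + (2 * real \<Delta> - real n - 1) / sqrt (real \<Delta> + 1) + 1 / 2"
    have b: "b = long_paths_bound n \<Delta> - pendant_slack \<Delta> * real (2 * \<Delta> - n - 1)"
      using \<Delta> by (simp add: b_def long_paths_bound_def pendant_slack_def of_nat_diff algebra_simps
          add_divide_distrib diff_divide_distrib)
    have "2 * \<Delta> - n - 1 \<le> L y"
      using card_pendant_neighbours_ge[OF simple conn unicyclic_card_edges[OF assms(3)] _ y(1)] n3
        assms(4) y(2) by (simp add: L_def)
    then have le: "pendant_slack \<Delta> * real (2 * \<Delta> - n - 1) \<le> pendant_slack \<Delta> * real (L y)"
      using pendant_slack_pos[OF \<open>3 \<le> \<Delta>\<close>] by (intro mult_left_mono) auto
    have "?\<chi> \<le> b"
      using bound(1) le b by linarith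
    moreover have "graph_iso G (U_graph n \<Delta>)" if eq: "?\<chi> = b"
    proof -
      \<comment> \<open>Equality with \<open>b\<close> closes the chain of both estimates;
        cancelling the positive slack then determines \<open>L y\<close>.\<close>
      have "pendant_slack \<Delta> * real (L y) = pendant_slack \<Delta> * real (2 * \<Delta> - n - 1)"
        using eq bound(1) le b by linarith
      then have "L y = 2 * \<Delta> - n - 1"
        using pendant_slack_pos[OF \<open>3 \<le> \<Delta>\<close>] by simp
      moreover obtain C ps where "cycle_with_paths C y ps" "G = attach_paths y C ps"
        "length ps = \<Delta> - 2" "length (filter (\<lambda>p. length p = 1) ps) = L y"
        using shape eq le b by force
      ultimately show ?thesis
        using graph_iso_U_graph[OF _ _ \<Delta> assms(2)] assms(4) by metis
    qed
    moreover have "?\<chi> = b" if iso: "graph_iso G (U_graph n \<Delta>)"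
    proof -
      obtain C u ps where "cycle_with_paths C u ps" "G = attach_paths u C ps" "length ps = \<Delta> - 2"
        "length (filter (\<lambda>p. length p = 1) ps) = 2 * \<Delta> - n - 1"
        using U_graph_isoE[OF simple iso \<Delta> assms(2)] by blast
      then show ?thesis
        using exact[of C u ps] two b by simp
    qed
    ultimately show "let b = (real n - real \<Delta> - 1) / sqrt 3 + (real n - real \<Delta> + 1) / sqrt (real \<Delta> + 2)
      + (2 * real \<Delta> - real n - 1) / sqrt (real \<Delta> + 1) + 1 / 2
      in ?\<chi> \<le> b \<and> (?\<chi> = b \<longleftrightarrow> graph_iso G (U_graph n \<Delta>))"
      unfolding Let_def b_def[symmetric] by blast
  next
    have slack: "0 \<le> pendant_slack \<Delta>"
      using pendant_slack_pos[of \<Delta>] assms(1) by (cases "\<Delta> = 2") (auto simp: pendant_slack_def)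
    then have "?\<chi> \<le> long_paths_bound n \<Delta>"
      using bound(1) mult_nonneg_nonneg[OF slack, of "real (L y)"] by linarith
    moreover have "cycle_with_long_paths (\<Delta> - 2) G" if eq: "?\<chi> = long_paths_bound n \<Delta>"
    proof -
      have "pendant_slack \<Delta> * real (L y) = 0"
        using eq bound(1) mult_nonneg_nonneg[OF slack, of "real (L y)"] by linarith
      \<comment> \<open>The slack vanishes only for \<open>\<Delta> = 2\<close>, where no paths are
        attached; otherwise \<open>y\<close> has no pendant neighbour. Either way no path has length
        one.\<close>
      then have "\<Delta> = 2 \<or> L y = 0"
        using pendant_slack_pos[of \<Delta>] assms(1) by fastforce
      moreover obtain C ps where *: "cycle_with_paths C y ps" "G = attach_paths y C ps"
        "length ps = \<Delta> - 2" "length (filter (\<lambda>p. length p = 1) ps) = L y"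
        using shape eq \<open>pendant_slack \<Delta> * real (L y) = 0\<close> by auto
      ultimately have none: "filter (\<lambda>p. length p = 1) ps = []"
        by auto
      interpret cycle_with_paths C y ps by fact
      have "2 \<le> length p" if "p \<in> set ps" for p
      proof -
        have "length p \<noteq> 1"
          using none that by (auto simp: filter_empty_conv)
        moreover have "length p \<noteq> 0"
          using nonempty[OF that] by simp
        ultimately show ?thesis by linarith
      qed
      then show ?thesis
        using * cycle root distinct disjoint unfolding cycle_with_long_paths_def by blast
    qed
    moreover have "?\<chi> = long_paths_bound n \<Delta>" if clp: "cycle_with_long_paths (\<Delta> - 2) G"
    proof -
      obtain C u ps where *: "is_cycle C" "u \<in> verts C" "length ps = \<Delta> - 2"
        "\<forall>p\<in>set ps. 2 \<le> length p" "distinct (concat ps)" "set (concat ps) \<inter> verts C = {}"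
        "G = attach_paths u C ps"
        using clp unfolding cycle_with_long_paths_def by blast
      then have "cycle_with_paths C u ps"
        by unfold_locales auto
      moreover have "filter (\<lambda>p. length p = 1) ps = []"
        using *(4) by (auto simp: filter_empty_conv)
      ultimately show ?thesis
        using exact[of C u ps] * two by simp
    qed
    ultimately show "let b = (real \<Delta> - 2) / sqrt 3 + real \<Delta> / sqrt (real \<Delta> + 2)
        + 1 / 2 * (real n - 2 * real \<Delta> + 2)
      in ?\<chi> \<le> b \<and> (?\<chi> = b \<longleftrightarrow> cycle_with_long_paths (\<Delta> - 2) G)"
      unfolding Let_def long_paths_bound_def[symmetric] by blast
  qed
qed

end
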